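(* Let $x \in \underline{\Delta}_2$ with $x>0$, $x\notin\Sigma_1$ and $x\notin\Pi_1$ be arbitrary. Let $\sigma_1^2,\sigma_2^2\in\mathbb{R}_c$ with $\sigma_1^2>0$, $\sigma_2^2>0$ be arbitrary but fixed. Then there exist continuous probability density functions $f_{\alpha_1}, f_{\alpha_2}\colon\mathbb{R}\to[0,\infty)$, both computable in $\mathcal{L}^1(\mathbb{R})$, such that for every computable $P>0$ there is a computable number $u(P)\in\mathbb{R}_c$ with $$C_S(P,f_{\alpha_1},f_{\alpha_2},\sigma_1^2,\sigma_2^2) = x + u(P).$$ Consequently, for all $P\in\mathbb{R}_c$ with $P>0$, $C_S(P,f_{\alpha_1},f_{\alpha_2},\sigma_1^2,\sigma_2^2)\in\underline{\Delta}_2$, while $C_S(P,f_{\alpha_1},f_{\alpha_2},\sigma_1^2,\sigma_2^2)\notin\Sigma_1$ and $C_S(P,f_{\alpha_1},f_{\alpha_2},\sigma_1^2,\sigma_2^2)\notin\Pi_1$.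
   Context: $\log$ denotes the logarithm to base $2$ and $\ln$ the natural logarithm. For a power constraint $P>0$, noise powers $\sigma_1^2,\sigma_2^2>0$, and fading probability density functions $f_{\alpha_1},f_{\alpha_2}$ on $\mathbb{R}$, the secrecy capacity of the fast-fading Gaussian wiretap channel (CSI at the receiver only) is $$C_S(P,f_{\alpha_1},f_{\alpha_2},\sigma_1^2,\sigma_2^2)=\int_{-\infty}^{\infty}\log\Big(1+\frac{P\alpha^2}{\sigma_1^2}\Big)f_{\alpha_1}(\alpha)\,d\alpha-\int_{-\infty}^{\infty}\log\Big(1+\frac{P\alpha^2}{\sigma_2^2}\Big)f_{\alpha_2}(\alpha)\,d\alpha.$$ A sequence of rationals $(r_n)$ is computable if $r_n=(-1)^{s(n)}a(n)/b(n)$ for recursive $a,b,s\colon\mathbb{N}\to\mathbb{N}$ with $b(n)\neq0$. A real $x$ is computable ($x\in\mathbb{R}_c$) if there is a computable sequence of rationals $(r_n)$ with $|x-r_n|<2^{-n}$ for all $n$. A sequence of reals $(x_n)$ is computable if there is a computable double sequence of rationals $(r_{m,n})$ with $|r_{m,n}-x_n|\le 2^{-m}$ for all $m,n$. $\Sigma_1$ is the set of reals that are limits of a monotonically nondecreasing computable sequence of rationals; $\Pi_1$ is the set of reals that are limits of a monotonically nonincreasing computable sequence of rationals; $\mathbb{R}_c=\Sigma_1\cap\Pi_1$. $\underline{\Delta}_2$ is the set of reals $x$ for which there exist $a,b\in\Sigma_1$ with $x=a-b$. A function $f$ on a computable interval is computable continuous if it maps computable sequences of reals to computable sequences of reals and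 is effectively uniformly continuous (there is a recursive $d\colon\mathbb{N}\to\mathbb{N}$ with $|x-y|\le 1/d(N)\Rightarrow|f(x)-f(y)|\le 2^{-N}$). A function $f\in\mathcal{L}^1(\mathbb{R})$ is computable in $\mathcal{L}^1(\mathbb{R})$ if there exist a computable sequence $(f_n)$ of computable functions in $\mathcal{L}^1(\mathbb{R})$ and a recursive $e\colon\mathbb{N}\to\mathbb{N}$ with $\|f-f_n\|_1\le 2^{-M}$ for all $n\ge e(M)$. *)

theory Defs
  imports "HOL-Analysis.Analysis"
begin

datatype rf = Z | S | Id nat | Cn rf "rf list" | Pr rf rf | Mn rf

inductive rf_eval :: "rf \<Rightarrow> nat list \<Rightarrow> nat \<Rightarrow> bool" where
  zero: "rf_eval Z xs 0"
| succ: "rf_eval S (x # xs) (Suc x)"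
| proj: "i < length xs \<Longrightarrow> rf_eval (Id i) xs (xs ! i)"
| comp: "length ys = length gs \<Longrightarrow> (\<forall>i < length gs. rf_eval (gs ! i) xs (ys ! i))
          \<Longrightarrow> rf_eval f ys z \<Longrightarrow> rf_eval (Cn f gs) xs z"
| prec0: "rf_eval f xs z \<Longrightarrow> rf_eval (Pr f g) (0 # xs) z"
| precS: "rf_eval (Pr f g) (n # xs) y \<Longrightarrow> rf_eval g (y # n # xs) z
          \<Longrightarrow> rf_eval (Pr f g) (Suc n # xs) z"
| mini: "rf_eval f (n # xs) 0 \<Longrightarrow> (\<forall>m < n. \<exists>y. 0 < y \<and> rf_eval f (m # xs) y)
          \<Longrightarrow> rf_eval (Mn f) xs n"

definition recursive_on :: "nat \<Rightarrow> (nat list \<Rightarrow> nat) \<Rightarrow> bool" where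
  "recursive_on k f \<longleftrightarrow> (\<exists>t. \<forall>xs. length xs = k \<longrightarrow> rf_eval t xs (f xs))"

definition recursive :: "(nat \<Rightarrow> nat) \<Rightarrow> bool" where
  "recursive f \<longleftrightarrow> recursive_on 1 (\<lambda>xs. f (xs ! 0))"

definition comp_rat_fam :: "nat \<Rightarrow> (nat list \<Rightarrow> real) \<Rightarrow> bool" where
  "comp_rat_fam k r \<longleftrightarrow> (\<exists>a b s. recursive_on k a \<and> recursive_on k b \<and> recursive_on k s \<and>
     (\<forall>xs. length xs = k \<longrightarrow> b xs \<noteq> 0 \<and>
        r xs = (-1) ^ (s xs) * real (a xs) / real (b xs)))"

definition comp_rat_seq :: "(nat \<Rightarrow> real) \<Rightarrow> bool" where
  "comp_rat_seq r \<longleftrightarrow> comp_rat_fam 1 (\<lambda>xs. r (xs ! 0))"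

definition computable_real :: "real \<Rightarrow> bool" where
  "computable_real x \<longleftrightarrow> (\<exists>r. comp_rat_seq r \<and> (\<forall>n. \<bar>x - r n\<bar> < 2 powr - real n))"

definition comp_real_fam :: "nat \<Rightarrow> (nat list \<Rightarrow> real) \<Rightarrow> bool" where
  "comp_real_fam k x \<longleftrightarrow> (\<exists>r. comp_rat_fam (Suc k) r \<and>
     (\<forall>m xs. length xs = k \<longrightarrow> \<bar>r (m # xs) - x xs\<bar> \<le> 2 powr - real m))"

definition comp_real_seq :: "(nat \<Rightarrow> real) \<Rightarrow> bool" where
  "comp_real_seq x \<longleftrightarrow> comp_real_fam 1 (\<lambda>xs. x (xs ! 0))"

definition Sigma1 :: "real set" where
  "Sigma1 = {x. \<exists>r. comp_rat_seq r \<and> incseq r \<and> r \<longlonglongrightarrow> x}"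

definition Pi1 :: "real set" where
  "Pi1 = {x. \<exists>r. comp_rat_seq r \<and> decseq r \<and> r \<longlonglongrightarrow> x}"

definition Delta2 :: "real set" where
  "Delta2 = {x. \<exists>a\<in>Sigma1. \<exists>b\<in>Sigma1. x = a - b}"

text \<open>A computable sequence of computable (continuous) functions on the real line, in the sense
  of Pour-El and Richards: sequentially computable and effectively uniformly continuous on every
  interval [-M, M], uniformly in the index.\<close>
definition comp_fun_seq :: "(nat \<Rightarrow> real \<Rightarrow> real) \<Rightarrow> bool" where
  "comp_fun_seq f \<longleftrightarrow>
     (\<forall>x. comp_real_seq x \<longrightarrow> comp_real_fam 2 (\<lambda>xs. f (xs ! 0) (x (xs ! 1)))) \<and>
     (\<exists>d. recursive_on 3 d \<and>
        (\<forall>n M N. d [n, M, N] > 0 \<and>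
           (\<forall>x y. \<bar>x\<bar> \<le> real M \<longrightarrow> \<bar>y\<bar> \<le> real M \<longrightarrow>
              \<bar>x - y\<bar> \<le> 1 / real (d [n, M, N]) \<longrightarrow> \<bar>f n x - f n y\<bar> \<le> 2 powr - real N)))"

definition computable_L1 :: "(real \<Rightarrow> real) \<Rightarrow> bool" where
  "computable_L1 f \<longleftrightarrow> integrable lborel f \<and>
     (\<exists>fs e. comp_fun_seq fs \<and> (\<forall>n. integrable lborel (fs n)) \<and> recursive e \<and>
        (\<forall>M n. e M \<le> n \<longrightarrow> (LINT t|lborel. \<bar>f t - fs n t\<bar>) \<le> 2 powr - real M))"

definition cont_pdf :: "(real \<Rightarrow> real) \<Rightarrow> bool" where
  "cont_pdf f \<longleftrightarrow> continuous_on UNIV f \<and> (\<forall>t. 0 \<le> f t) \<and>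
     integrable lborel f \<and> (LINT t|lborel. f t) = 1"

definition secrecy_capacity ::
  "real \<Rightarrow> (real \<Rightarrow> real) \<Rightarrow> (real \<Rightarrow> real) \<Rightarrow> real \<Rightarrow> real \<Rightarrow> real" where
  "secrecy_capacity P f1 f2 s1 s2 =
     (LINT a|lborel. log 2 (1 + P * a\<^sup>2 / s1) * f1 a) -
     (LINT a|lborel. log 2 (1 + P * a\<^sup>2 / s2) * f2 a)"

end

(* Write x = a - b with a, b limits of nondecreasing computable rational sequences r. The density for
   a is a mixture of tents supported on [2^n, 2^(n+1)], where log2 (1 + P t^2 / s) is 2 n plus a
   bounded correction. With A k = D 2^k and w k = (r (k+1) - r k) / (2 A k) <= 2^-(k+1), weight w k is
   placed at scale A k and the rest of 2^-(k+1) at scale 0. The main terms 2 (w k) (A k) telescope to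
   a - r 0, with no computable rate, whereas the weights and hence the corrections are dominated by
   2^-k: the density is computable in L^1 and the corrections sum to a computable real. Two such
   densities give x plus a computable real, and the three classes are invariant under adding
   computable reals. *)
theory Submission
  imports Defs
begin

section \<open>Recursive functions\<close>

text \<open>The obstacle: the increments of \<open>r\<close> are computable, but their sum has no
  computable rate of convergence. Used directly as weights, they would give a density with no
  effective approximation, whose mass is as hard to compute as \<open>a\<close>. Dividing by
  \<open>A k\<close>, which doubles with \<open>k\<close>, turns the mere bound \<open>D\<close> on
  all increments into a rate, and the logarithm gives the factor back, since a point near 2^(A k)
  has logarithm of order \<open>A k\<close>. Filling every index up to mass exactly 2^-(k+1) makes
  the total mass 1 without normalization. \<open>D\<close> only has to exist: one fixed natural
  number is a recursive constant, so nothing is computed from \<open>a\<close>. One density serves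
  every \<open>P\<close> because, at t = 2^n (1 + v), the quantity 1 + P t^2 / s equals 4^n (s / 4^n
  + P (1 + v)^2) / s. For v in [0, 1] the middle factor lies in [P, s + 4 P], so \<open>P\<close>
  and \<open>s\<close> influence only the correction and never the main term 2 n. Computability is
  proved for families indexed by argument lists, because a series or an integral needs its terms to
  be computable uniformly in the index.\<close>

lemma recursive_on_cong:
  assumes "\<And>xs. length xs = k \<Longrightarrow> f xs = g xs"
  shows "recursive_on k f \<longleftrightarrow> recursive_on k g"
  using assms by (simp add: recursive_on_def)

lemma recursive_on_nth: "i < k \<Longrightarrow> recursive_on k (\<lambda>xs. xs ! i)"
  unfolding recursive_on_def by (rule exI[of _ "Id i"]) (auto intro: rf_eval.proj)

lemma recursive_on_comp:
  assumes "recursive_on (length gs) f" and "\<And>g. g \<in> set gs \<Longrightarrow> recursive_on k g"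
  shows "recursive_on k (\<lambda>xs. f (map (\<lambda>g. g xs) gs))"
proof -
  obtain t where t: "\<And>ys. length ys = length gs \<Longrightarrow> rf_eval t ys (f ys)"
    using assms(1) by (auto simp: recursive_on_def)
  have "\<forall>g\<in>set gs. \<exists>u. \<forall>xs. length xs = k \<longrightarrow> rf_eval u xs (g xs)"
    using assms(2) by (auto simp: recursive_on_def)
  then obtain u where u: "\<And>g xs. g \<in> set gs \<Longrightarrow> length xs = k \<Longrightarrow> rf_eval (u g) xs (g xs)"
    by (metis (no_types))
  have "rf_eval (Cn t (map u gs)) xs (f (map (\<lambda>g. g xs) gs))" if "length xs = k" for xs
    by (rule rf_eval.comp[where ys = "map (\<lambda>g. g xs) gs"]) (auto intro: t u that)
  then show ?thesis by (auto simp: recursive_on_def)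
qed

text \<open>Treating the argument list as one object makes every change of variables an instance of
  a single substitution rule, with side conditions about \<open>hd\<close>, \<open>tl\<close> and
  Cons only.\<close>

definition recursive_list :: "nat \<Rightarrow> nat \<Rightarrow> (nat list \<Rightarrow> nat list) \<Rightarrow> bool" where
  "recursive_list k m G \<longleftrightarrow> (\<forall>xs. length xs = k \<longrightarrow> length (G xs) = m) \<and>
     (\<forall>i<m. recursive_on k (\<lambda>xs. G xs ! i))"

lemma recursive_list_length: "recursive_list k m G \<Longrightarrow> length xs = k \<Longrightarrow> length (G xs) = m"
  by (simp add: recursive_list_def)

lemma recursive_list_Nil: "recursive_list k 0 (\<lambda>xs. [])"
  by (simp add: recursive_list_def)

lemma recursive_list_id: "recursive_list k k (\<lambda>xs. xs)"
  by (simp add: recursive_list_def recursive_on_nth)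

lemma recursive_list_Cons:
  assumes "recursive_on k g" "recursive_list k m G"
  shows "recursive_list k (Suc m) (\<lambda>xs. g xs # G xs)"
  unfolding recursive_list_def
proof (intro conjI allI impI)
  fix i assume "i < Suc m"
  then show "recursive_on k (\<lambda>xs. (g xs # G xs) ! i)"
    using assms by (cases i) (auto simp: recursive_list_def)
qed (use assms in \<open>auto simp: recursive_list_def\<close>)

lemma recursive_on_list_nth: "recursive_list k m G \<Longrightarrow> i < m \<Longrightarrow> recursive_on k (\<lambda>xs. G xs ! i)"
  by (simp add: recursive_list_def)

lemma recursive_list_tl:
  assumes "recursive_list k (Suc m) G"
  shows "recursive_list k m (\<lambda>xs. tl (G xs))"
  unfolding recursive_list_def
proof (intro conjI allI impI)
  fix i assume "i < m"
  then have "recursive_on k (\<lambda>xs. G xs ! Suc i)"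
    using assms by (auto simp: recursive_list_def)
  moreover have "recursive_on k (\<lambda>xs. tl (G xs) ! i) \<longleftrightarrow> recursive_on k (\<lambda>xs. G xs ! Suc i)"
    using assms \<open>i < m\<close> by (intro recursive_on_cong) (auto simp: nth_tl recursive_list_def)
  ultimately show "recursive_on k (\<lambda>xs. tl (G xs) ! i)" by simp
qed (use assms in \<open>auto simp: recursive_list_def\<close>)

lemma recursive_on_hd:
  assumes "recursive_list k (Suc m) G"
  shows "recursive_on k (\<lambda>xs. hd (G xs))"
proof -
  have "recursive_on k (\<lambda>xs. hd (G xs)) \<longleftrightarrow> recursive_on k (\<lambda>xs. G xs ! 0)"
    by (rule recursive_on_cong) (metis assms hd_conv_nth list.size(3) nat.distinct(1) recursive_list_length)
  then show ?thesis
    using assms by (simp add: recursive_list_def)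
qed

lemma recursive_on_subst:
  assumes "recursive_on m F" "recursive_list k m G"
  shows "recursive_on k (\<lambda>xs. F (G xs))"
proof -
  \<comment> \<open>\<open>Cn\<close> wants a list of functions, so the list-valued \<open>G\<close>
    is split into its \<open>m\<close> components. They rebuild \<open>G xs\<close> only when
    \<open>xs\<close> has length \<open>k\<close>.\<close>
  define gs where "gs = map (\<lambda>i xs. G xs ! i) [0..<m]"
  have "recursive_on k (\<lambda>xs. F (map (\<lambda>g. g xs) gs))"
    using assms by (intro recursive_on_comp) (auto simp: gs_def recursive_list_def)
  moreover have "map (\<lambda>g. g xs) gs = G xs" if "length xs = k" for xs
    using assms that by (intro nth_equalityI) (auto simp: gs_def recursive_list_def)
  ultimately show ?thesis
    by (subst (asm) recursive_on_cong[where g = "\<lambda>xs. F (G xs)"]) auto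
qed

lemma recursive_on_Suc:
  assumes "recursive_on k f" shows "recursive_on k (\<lambda>xs. Suc (f xs))"
proof -
  have "recursive_on 1 (\<lambda>xs. Suc (hd xs))"
    unfolding recursive_on_def
    by (rule exI[of _ S]) (auto simp: length_Suc_conv intro: rf_eval.succ)
  from recursive_on_subst[OF this, of k "\<lambda>xs. [f xs]"] show ?thesis
    using assms by (simp add: recursive_list_Cons recursive_list_Nil)
qed

lemma recursive_on_const: "recursive_on k (\<lambda>xs. c)"
proof (induction c)
  case 0
  show ?case unfolding recursive_on_def by (rule exI[of _ Z]) (auto intro: rf_eval.zero)
qed (rule recursive_on_Suc)

text \<open>\<open>Pr\<close> hands its step the accumulated value first, then the counter, then the
  parameters. Hence \<open>g\<close> takes its counter from \<open>hd (tl ys)\<close> and the value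
  from \<open>hd ys\<close>.\<close>

lemma recursive_on_rec_nat:
  assumes f: "recursive_on k f"
    and g: "recursive_on (Suc (Suc k)) (\<lambda>ys. g (hd (tl ys)) (hd ys) (tl (tl ys)))"
    and N: "recursive_on k N"
  shows "recursive_on k (\<lambda>xs. rec_nat (f xs) (\<lambda>n y. g n y xs) (N xs))"
proof -
  define h where "h = (\<lambda>ys. rec_nat (f (tl ys)) (\<lambda>n y. g n y (tl ys)) (hd ys))"
  obtain t where t: "\<And>xs. length xs = k \<Longrightarrow> rf_eval t xs (f xs)"
    using f by (auto simp: recursive_on_def)
  obtain u where u: "\<And>xs. length xs = Suc (Suc k) \<Longrightarrow> rf_eval u xs (g (hd (tl xs)) (hd xs) (tl (tl xs)))"
    using g by (auto simp: recursive_on_def)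
  have "rf_eval (Pr t u) (n # xs) (h (n # xs))" if "length xs = k" for n xs
  proof (induction n)
    case 0
    then show ?case using t[OF that] by (simp add: h_def rf_eval.prec0)
  next
    case (Suc n)
    show ?case
      by (rule rf_eval.precS[OF Suc]) (use u[of "h (n # xs) # n # xs"] that in \<open>simp add: h_def\<close>)
  qed
  then have "recursive_on (Suc k) h"
    unfolding recursive_on_def by (metis length_Suc_conv)
  from recursive_on_subst[OF this, of k "\<lambda>xs. N xs # xs"] show ?thesis
    using N by (simp add: h_def recursive_list_Cons recursive_list_id)
qed

text \<open>A bound variable of a sum, product or recursion is consed onto the argument list, so in the
  body the outer arguments are reached through \<^term>\<open>tl\<close>.\<close>
lemmas recursive_on_vars =
  recursive_on_hd recursive_on_list_nth recursive_list_tl recursive_list_id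
  recursive_list_Cons recursive_list_Nil

section \<open>Arithmetic, case distinctions, bounded sums and products\<close>

lemma recursive_on_add:
  assumes "recursive_on k f" "recursive_on k g"
  shows "recursive_on k (\<lambda>xs. f xs + g xs)"
proof -
  have eq: "rec_nat b (\<lambda>n y. Suc y) a = a + b" for a b :: nat by (induction a) auto
  have "recursive_on k (\<lambda>xs. rec_nat (g xs) (\<lambda>n y. Suc y) (f xs))"
    by (rule recursive_on_rec_nat assms recursive_on_Suc recursive_on_vars)+
  then show ?thesis by (simp only: eq)
qed

lemma recursive_on_mult:
  assumes "recursive_on k f" "recursive_on k g"
  shows "recursive_on k (\<lambda>xs. f xs * g xs)"
proof -
  have eq: "rec_nat 0 (\<lambda>n y. y + b) a = a * b" for a b :: nat by (induction a) auto
  have "recursive_on k (\<lambda>xs. rec_nat 0 (\<lambda>n y. y + g xs) (f xs))"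
    by (rule recursive_on_rec_nat[where g = "\<lambda>n y xs. y + g xs"] assms recursive_on_add
        recursive_on_const recursive_on_vars recursive_on_subst[OF assms(2)])+
  then show ?thesis by (simp only: eq)
qed

lemma recursive_on_power:
  assumes "recursive_on k f" "recursive_on k g"
  shows "recursive_on k (\<lambda>xs. f xs ^ g xs)"
proof -
  have eq: "rec_nat 1 (\<lambda>n y. y * b) a = b ^ a" for a b :: nat by (induction a) auto
  have "recursive_on k (\<lambda>xs. rec_nat 1 (\<lambda>n y. y * f xs) (g xs))"
    by (rule recursive_on_rec_nat[where g = "\<lambda>n y xs. y * f xs"] assms recursive_on_mult
        recursive_on_const recursive_on_vars recursive_on_subst[OF assms(1)])+
  then show ?thesis by (simp only: eq)
qed

text \<open>Truncated subtraction iterates the predecessor, and the predecessor is a recursion whose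
  step forgets the value and returns the counter.\<close>

lemma recursive_on_diff:
  assumes "recursive_on k f" "recursive_on k g"
  shows "recursive_on k (\<lambda>xs. f xs - g xs)"
proof -
  have pred: "recursive_on l (\<lambda>xs. h xs - 1)" if "recursive_on l h" for l h
  proof -
    have eq: "rec_nat 0 (\<lambda>n y. n) a = a - 1" for a :: nat by (induction a) auto
    have "recursive_on l (\<lambda>xs. rec_nat 0 (\<lambda>n y. n) (h xs))"
      by (rule recursive_on_rec_nat that recursive_on_const recursive_on_vars)+
    then show ?thesis by (simp only: eq)
  qed
  have eq: "rec_nat a (\<lambda>n y. y - 1) b = a - b" for a b :: nat by (induction b) auto
  have "recursive_on k (\<lambda>xs. rec_nat (f xs) (\<lambda>n y. y - 1) (g xs))"
    by (rule recursive_on_rec_nat[where g = "\<lambda>n y xs. y - 1"] assms pred recursive_on_vars)+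
  then show ?thesis by (simp only: eq)
qed

lemma recursive_on_if_le:
  assumes "recursive_on k f" "recursive_on k g" "recursive_on k u" "recursive_on k v"
  shows "recursive_on k (\<lambda>xs. if f xs \<le> g xs then u xs else v xs)"
proof -
  \<comment> \<open>Under truncated subtraction \<open>1 - (f xs - g xs)\<close> is the 0-1
    indicator of \<open>f xs \<le> g xs\<close>, so the conditional becomes arithmetic.\<close>
  have "recursive_on k (\<lambda>xs. (1 - (f xs - g xs)) * u xs + (1 - (1 - (f xs - g xs))) * v xs)"
    by (intro recursive_on_add recursive_on_mult recursive_on_diff recursive_on_const assms)
  then show ?thesis
    by (rule recursive_on_cong[THEN iffD1, rotated]) auto
qed

lemma recursive_on_if_even:
  assumes "recursive_on k f" "recursive_on k u" "recursive_on k v"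
  shows "recursive_on k (\<lambda>xs. if even (f xs) then u xs else v xs)"
proof -
  \<comment> \<open>Parity arises by flipping between 0 and 1.\<close>
  have eq: "rec_nat 0 (\<lambda>n y. 1 - y) a = (if even a then 0 else 1 :: nat)" for a :: nat
    by (induction a) simp_all
  have "recursive_on k (\<lambda>xs. rec_nat 0 (\<lambda>n y. 1 - y) (f xs))"
    by (rule recursive_on_rec_nat[where g = "\<lambda>n y xs. 1 - y"] assms recursive_on_diff
        recursive_on_const recursive_on_vars)+
  then have "recursive_on k (\<lambda>xs. if even (f xs) then 0 else 1)" by (simp only: eq)
  then have "recursive_on k (\<lambda>xs. if (if even (f xs) then 0 else 1) \<le> (0::nat) then u xs else v xs)"
    by (rule recursive_on_if_le[OF _ recursive_on_const assms(2,3)])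
  then show ?thesis
    by (rule recursive_on_cong[THEN iffD1, rotated]) auto
qed

lemma recursive_on_sum:
  assumes F: "recursive_on (Suc k) (\<lambda>ys. F (hd ys) (tl ys))" and N: "recursive_on k N"
  shows "recursive_on k (\<lambda>xs. \<Sum>i<N xs. F i xs)"
proof -
  have eq: "rec_nat 0 (\<lambda>n y. y + F n xs) a = (\<Sum>i<a. F i xs)" for xs a by (induction a) auto
  \<comment> \<open>Inside the recursion the list is value, counter, parameters; without its head it
    is the list that \<open>F\<close> expects.\<close>
  have "recursive_on (Suc (Suc k)) (\<lambda>ys. F (hd (tl ys)) (tl (tl ys)))"
    by (rule recursive_on_subst[OF F, of "Suc (Suc k)" "\<lambda>ys. tl ys"] recursive_list_tl recursive_list_id)+
  note F' = this
  have "recursive_on k (\<lambda>xs. rec_nat 0 (\<lambda>n y. y + F n xs) (N xs))"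
    by (rule recursive_on_rec_nat[where g = "\<lambda>n y xs. y + F n xs"] N F' recursive_on_add
        recursive_on_const recursive_on_vars)+
  then show ?thesis by (simp only: eq)
qed

lemma recursive_on_prod:
  assumes F: "recursive_on (Suc k) (\<lambda>ys. F (hd ys) (tl ys))" and N: "recursive_on k N"
  shows "recursive_on k (\<lambda>xs. \<Prod>i<N xs. F i xs)"
proof -
  have eq: "rec_nat 1 (\<lambda>n y. y * F n xs) a = (\<Prod>i<a. F i xs)" for xs a by (induction a) auto
  have "recursive_on (Suc (Suc k)) (\<lambda>ys. F (hd (tl ys)) (tl (tl ys)))"
    by (rule recursive_on_subst[OF F, of "Suc (Suc k)" "\<lambda>ys. tl ys"] recursive_list_tl recursive_list_id)+
  note F' = this
  have "recursive_on k (\<lambda>xs. rec_nat 1 (\<lambda>n y. y * F n xs) (N xs))"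
    by (rule recursive_on_rec_nat[where g = "\<lambda>n y xs. y * F n xs"] N F' recursive_on_mult
        recursive_on_const recursive_on_vars)+
  then show ?thesis by (simp only: eq)
qed

section \<open>Computable families of rationals\<close>

lemma comp_rat_fam_cong:
  assumes "\<And>xs. length xs = k \<Longrightarrow> f xs = g xs"
  shows "comp_rat_fam k f \<longleftrightarrow> comp_rat_fam k g"
  using assms by (simp add: comp_rat_fam_def)

text \<open>With a difference of naturals as numerator, sums and products of rationals are
  polynomial in numerators and denominators. The sign exponent of the definition would force case
  distinctions in every closure rule.\<close>

lemma comp_rat_fam_iff_diff:
  "comp_rat_fam k r \<longleftrightarrow> (\<exists>p m b. recursive_on k p \<and> recursive_on k m \<and> recursive_on k b \<and>
     (\<forall>xs. length xs = k \<longrightarrow> b xs \<noteq> 0 \<and> r xs = (real (p xs) - real (m xs)) / real (b xs)))"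
    (is "_ \<longleftrightarrow> ?R")
proof
  assume "comp_rat_fam k r"
  then obtain a b s where *: "recursive_on k a" "recursive_on k b" "recursive_on k s"
    and r: "\<And>xs. length xs = k \<Longrightarrow> b xs \<noteq> 0"
           "\<And>xs. length xs = k \<Longrightarrow> r xs = (-1) ^ (s xs) * real (a xs) / real (b xs)"
    unfolding comp_rat_fam_def by blast
  show ?R
  proof (intro exI conjI allI impI)
    show "recursive_on k (\<lambda>xs. if even (s xs) then a xs else 0)"
      "recursive_on k (\<lambda>xs. if even (s xs) then 0 else a xs)" "recursive_on k b"
      by (intro recursive_on_if_even recursive_on_const *)+
    fix xs :: "nat list" assume "length xs = k"
    then show "b xs \<noteq> 0" "r xs = (real (if even (s xs) then a xs else 0) -
      real (if even (s xs) then 0 else a xs)) / real (b xs)"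
      using r[of xs] by auto
  qed
next
  assume ?R
  then obtain p m b where *: "recursive_on k p" "recursive_on k m" "recursive_on k b"
    and r: "\<And>xs. length xs = k \<Longrightarrow> b xs \<noteq> 0"
           "\<And>xs. length xs = k \<Longrightarrow> r xs = (real (p xs) - real (m xs)) / real (b xs)"
    by blast
  show "comp_rat_fam k r" unfolding comp_rat_fam_def
  proof (intro exI conjI allI impI)
    \<comment> \<open>At least one of the two truncated differences is 0, so their sum is the
      absolute value of the numerator.\<close>
    show "recursive_on k (\<lambda>xs. (p xs - m xs) + (m xs - p xs))" "recursive_on k b"
      "recursive_on k (\<lambda>xs. if m xs \<le> p xs then 0 else 1)"
      by (intro recursive_on_add recursive_on_diff recursive_on_if_le recursive_on_const *)+
    fix xs :: "nat list" assume "length xs = k"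
    then show "b xs \<noteq> 0" "r xs = (- 1) ^ (if m xs \<le> p xs then 0 else 1) *
      real ((p xs - m xs) + (m xs - p xs)) / real (b xs)"
      using r[of xs] by (auto simp: of_nat_diff)
  qed
qed

lemma comp_rat_famE:
  assumes "comp_rat_fam k r"
  obtains p m b where "recursive_on k p" "recursive_on k m" "recursive_on k b"
    "\<And>xs. length xs = k \<Longrightarrow> b xs \<noteq> 0"
    "\<And>xs. length xs = k \<Longrightarrow> r xs = (real (p xs) - real (m xs)) / real (b xs)"
  using assms unfolding comp_rat_fam_iff_diff by blast

lemma comp_rat_famI:
  assumes "recursive_on k p" "recursive_on k m" "recursive_on k b"
    "\<And>xs. length xs = k \<Longrightarrow> b xs \<noteq> 0"
    "\<And>xs. length xs = k \<Longrightarrow> r xs = (real (p xs) - real (m xs)) / real (b xs)"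
  shows "comp_rat_fam k r"
  using assms unfolding comp_rat_fam_iff_diff by blast

lemma comp_rat_fam_subst:
  assumes "comp_rat_fam m F" "recursive_list k m G"
  shows "comp_rat_fam k (\<lambda>xs. F (G xs))"
proof -
  obtain a b s where *: "recursive_on m a" "recursive_on m b" "recursive_on m s"
    and r: "\<And>xs. length xs = m \<Longrightarrow> b xs \<noteq> 0 \<and> F xs = (-1) ^ (s xs) * real (a xs) / real (b xs)"
    using assms(1) unfolding comp_rat_fam_def by blast
  show ?thesis unfolding comp_rat_fam_def
    by (rule exI[of _ "\<lambda>xs. a (G xs)"], rule exI[of _ "\<lambda>xs. b (G xs)"], rule exI[of _ "\<lambda>xs. s (G xs)"])
       (use assms(2) r in \<open>auto intro!: recursive_on_subst[OF _ assms(2)] * dest: recursive_list_length\<close>)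
qed

lemma comp_rat_fam_of_nat:
  assumes "recursive_on k f" shows "comp_rat_fam k (\<lambda>xs. real (f xs))"
  by (rule comp_rat_famI[of k f "\<lambda>_. 0" "\<lambda>_. 1"]) (auto intro: assms recursive_on_const)

lemma comp_rat_fam_numeral: "comp_rat_fam k (\<lambda>xs. numeral n)"
  using comp_rat_fam_of_nat[OF recursive_on_const[of k "numeral n"]] by simp

lemma comp_rat_fam_0: "comp_rat_fam k (\<lambda>xs. 0)"
  using comp_rat_fam_of_nat[OF recursive_on_const[of k 0]] by simp

lemma comp_rat_fam_1: "comp_rat_fam k (\<lambda>xs. 1)"
  using comp_rat_fam_of_nat[OF recursive_on_const[of k 1]] by simp

lemma comp_rat_fam_uminus:
  assumes "comp_rat_fam k r" shows "comp_rat_fam k (\<lambda>xs. - r xs)"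
proof -
  obtain p m b where *: "recursive_on k p" "recursive_on k m" "recursive_on k b"
    "\<And>xs. length xs = k \<Longrightarrow> b xs \<noteq> 0"
    "\<And>xs. length xs = k \<Longrightarrow> r xs = (real (p xs) - real (m xs)) / real (b xs)"
    using comp_rat_famE[OF assms] by metis
  show ?thesis
    by (rule comp_rat_famI[of k m p b]) (use * in \<open>auto simp: minus_divide_left\<close>)
qed

lemma comp_rat_fam_add:
  assumes "comp_rat_fam k r" "comp_rat_fam k r'" shows "comp_rat_fam k (\<lambda>xs. r xs + r' xs)"
proof -
  obtain p m b where *: "recursive_on k p" "recursive_on k m" "recursive_on k b"
    "\<And>xs. length xs = k \<Longrightarrow> b xs \<noteq> 0"
    "\<And>xs. length xs = k \<Longrightarrow> r xs = (real (p xs) - real (m xs)) / real (b xs)"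
    using comp_rat_famE[OF assms(1)] by metis
  obtain p' m' b' where **: "recursive_on k p'" "recursive_on k m'" "recursive_on k b'"
    "\<And>xs. length xs = k \<Longrightarrow> b' xs \<noteq> 0"
    "\<And>xs. length xs = k \<Longrightarrow> r' xs = (real (p' xs) - real (m' xs)) / real (b' xs)"
    using comp_rat_famE[OF assms(2)] by metis
  show ?thesis
    by (rule comp_rat_famI[of k "\<lambda>xs. p xs * b' xs + p' xs * b xs" "\<lambda>xs. m xs * b' xs + m' xs * b xs"
          "\<lambda>xs. b xs * b' xs"])
       (intro recursive_on_add recursive_on_mult * ** | simp add: *(4,5) **(4,5) field_simps)+
qed

lemma comp_rat_fam_diff:
  assumes "comp_rat_fam k r" "comp_rat_fam k r'" shows "comp_rat_fam k (\<lambda>xs. r xs - r' xs)"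
  using comp_rat_fam_add[OF assms(1) comp_rat_fam_uminus[OF assms(2)]] by simp

lemma comp_rat_fam_mult:
  assumes "comp_rat_fam k r" "comp_rat_fam k r'" shows "comp_rat_fam k (\<lambda>xs. r xs * r' xs)"
proof -
  obtain p m b where *: "recursive_on k p" "recursive_on k m" "recursive_on k b"
    "\<And>xs. length xs = k \<Longrightarrow> b xs \<noteq> 0"
    "\<And>xs. length xs = k \<Longrightarrow> r xs = (real (p xs) - real (m xs)) / real (b xs)"
    using comp_rat_famE[OF assms(1)] by metis
  obtain p' m' b' where **: "recursive_on k p'" "recursive_on k m'" "recursive_on k b'"
    "\<And>xs. length xs = k \<Longrightarrow> b' xs \<noteq> 0"
    "\<And>xs. length xs = k \<Longrightarrow> r' xs = (real (p' xs) - real (m' xs)) / real (b' xs)"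
    using comp_rat_famE[OF assms(2)] by metis
  show ?thesis
    by (rule comp_rat_famI[of k "\<lambda>xs. p xs * p' xs + m xs * m' xs" "\<lambda>xs. p xs * m' xs + m xs * p' xs"
          "\<lambda>xs. b xs * b' xs"])
       (intro recursive_on_add recursive_on_mult * ** | simp add: *(4,5) **(4,5) field_simps)+
qed

lemma comp_rat_fam_abs:
  assumes "comp_rat_fam k r" shows "comp_rat_fam k (\<lambda>xs. \<bar>r xs\<bar>)"
proof -
  obtain p m b where *: "recursive_on k p" "recursive_on k m" "recursive_on k b"
    "\<And>xs. length xs = k \<Longrightarrow> b xs \<noteq> 0"
    "\<And>xs. length xs = k \<Longrightarrow> r xs = (real (p xs) - real (m xs)) / real (b xs)"
    using comp_rat_famE[OF assms] by metis
  have real_abs: "\<bar>real i - real j\<bar> = real (i - j) + real (j - i)" for i j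
    by (auto simp: abs_if of_nat_diff)
  show ?thesis
    by (rule comp_rat_famI[of k "\<lambda>xs. (p xs - m xs) + (m xs - p xs)" "\<lambda>_. 0" b])
       (intro recursive_on_add recursive_on_diff recursive_on_const *(1-3) |
         simp add: *(4,5) abs_divide real_abs)+
qed

lemma comp_rat_fam_divide_nat:
  assumes "comp_rat_fam k r" "recursive_on k f" "\<And>xs. length xs = k \<Longrightarrow> f xs > 0"
  shows "comp_rat_fam k (\<lambda>xs. r xs / real (f xs))"
proof -
  have "comp_rat_fam k (\<lambda>xs. 1 / real (f xs))"
    by (rule comp_rat_famI[of k "\<lambda>_. 1" "\<lambda>_. 0" f]) (use assms in \<open>auto intro: recursive_on_const\<close>)
  from comp_rat_fam_mult[OF assms(1) this] show ?thesis by simp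
qed

lemma comp_rat_fam_divide_pow2:
  assumes "comp_rat_fam k r" "recursive_on k f"
  shows "comp_rat_fam k (\<lambda>xs. r xs / 2 ^ f xs)"
  using comp_rat_fam_divide_nat[OF assms(1) recursive_on_power[OF recursive_on_const[of k 2] assms(2)]]
  by simp

lemma comp_rat_fam_max:
  assumes "comp_rat_fam k r" "comp_rat_fam k r'" shows "comp_rat_fam k (\<lambda>xs. max (r xs) (r' xs))"
proof -
  \<comment> \<open>The maximum is half of sum plus distance; writing 2 as \<open>2 ^ 1\<close> lets
    the rule for powers of two supply the half.\<close>
  have "comp_rat_fam k (\<lambda>xs. (r xs + r' xs + \<bar>r xs - r' xs\<bar>) / 2 ^ 1)"
    by (intro comp_rat_fam_divide_pow2 comp_rat_fam_add comp_rat_fam_abs comp_rat_fam_diff assms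
        recursive_on_const)
  then show ?thesis
    by (rule comp_rat_fam_cong[THEN iffD1, rotated]) auto
qed

text \<open>The number of summands varies with the arguments, so closure under addition cannot
  simply be iterated. All terms are brought over the product of all denominators, and only sums and
  products of naturals remain. Equality of \<open>i\<close> and \<open>j\<close> is tested by two
  comparisons.\<close>

lemma comp_rat_fam_sum:
  assumes F: "comp_rat_fam (Suc k) (\<lambda>ys. F (hd ys) (tl ys))" and N: "recursive_on k N"
  shows "comp_rat_fam k (\<lambda>xs. \<Sum>i<N xs. F i xs)"
proof -
  obtain p m b where *: "recursive_on (Suc k) p" "recursive_on (Suc k) m" "recursive_on (Suc k) b"
    and pos: "\<And>xs. length xs = Suc k \<Longrightarrow> b xs \<noteq> 0"
    and eq: "\<And>xs. length xs = Suc k \<Longrightarrow>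
      F (hd xs) (tl xs) = (real (p xs) - real (m xs)) / real (b xs)"
    using comp_rat_famE[OF F] by metis
  \<comment> \<open>product of the denominators other than the i-th, which avoids integer division\<close>
  define c where "c i xs = (\<Prod>j<N xs. if j \<le> i then if i \<le> j then 1 else b (j # xs) else b (j # xs))"
    for i xs
  have rb: "recursive_on (Suc (Suc k)) (\<lambda>ys. b (hd ys # tl (tl ys)))"
    by (rule recursive_on_subst[OF *(3)] recursive_on_vars)+
  have rN: "recursive_on (Suc k) (\<lambda>ys. N (tl ys))"
    by (rule recursive_on_subst[OF N] recursive_on_vars)+
  have rc: "recursive_on (Suc k) (\<lambda>ys. c (hd ys) (tl ys))"
    unfolding c_def
    by (rule recursive_on_prod[where F = "\<lambda>j xs. if j \<le> hd xs then if hd xs \<le> j then 1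
          else b (j # tl xs) else b (j # tl xs)"] rN recursive_on_if_le rb recursive_on_const recursive_on_vars)+
  have rsum: "recursive_on k (\<lambda>xs. \<Sum>i<N xs. q (i # xs) * c i xs)" if "recursive_on (Suc k) q" for q
  proof (rule recursive_on_sum[OF _ N], rule recursive_on_mult)
    show "recursive_on (Suc k) (\<lambda>ys. q (hd ys # tl ys))"
      by (rule recursive_on_subst[OF that] recursive_on_vars)+
  qed (rule rc)
  have rprod: "recursive_on k (\<lambda>xs. \<Prod>i<N xs. b (i # xs))"
  proof (rule recursive_on_prod[OF _ N])
    show "recursive_on (Suc k) (\<lambda>ys. b (hd ys # tl ys))"
      by (rule recursive_on_subst[OF *(3)] recursive_on_vars)+
  qed
  show ?thesis
  proof (rule comp_rat_famI[OF rsum[OF *(1)] rsum[OF *(2)] rprod])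
    fix xs :: "nat list" assume len: "length xs = k"
    show "(\<Prod>i<N xs. b (i # xs)) \<noteq> 0"
      using pos len by simp
    have cb: "c i xs * b (i # xs) = (\<Prod>j<N xs. b (j # xs))" if "i < N xs" for i
    proof -
      have "(\<Prod>j<N xs. b (j # xs)) = b (i # xs) * (\<Prod>j\<in>{..<N xs} - {i}. b (j # xs))"
        using that by (subst prod.remove[of _ i]) auto
      also have "(\<Prod>j\<in>{..<N xs} - {i}. b (j # xs)) =
          (\<Prod>j\<in>{..<N xs} - {i}. if j \<le> i then if i \<le> j then 1 else b (j # xs) else b (j # xs))"
        by (intro prod.cong) auto
      also have "\<dots> = c i xs"
        unfolding c_def using that by (subst (2) prod.remove[of _ i]) auto
      finally show ?thesis by (simp add: mult.commute)
    qed
    have "F i xs = (real (p (i # xs)) * real (c i xs) - real (m (i # xs)) * real (c i xs)) /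
        real (\<Prod>i<N xs. b (i # xs))" if "i < N xs" for i
    proof -
      have "c i xs \<noteq> 0" using pos len by (simp add: c_def)
      moreover have "F i xs = (real (p (i # xs)) - real (m (i # xs))) / real (b (i # xs))"
        using eq[of "i # xs"] len by simp
      ultimately show ?thesis
        unfolding cb[OF that, symmetric] by (simp flip: left_diff_distrib)
    qed
    then show "(\<Sum>i<N xs. F i xs) = (real (\<Sum>i<N xs. p (i # xs) * c i xs) -
        real (\<Sum>i<N xs. m (i # xs) * c i xs)) / real (\<Prod>i<N xs. b (i # xs))"
      by (simp add: sum_subtractf sum_divide_distrib diff_divide_distrib)
  qed
qed

lemmas comp_rat_fam_intros =
  comp_rat_fam_of_nat comp_rat_fam_numeral comp_rat_fam_0 comp_rat_fam_1 comp_rat_fam_uminus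
  comp_rat_fam_add comp_rat_fam_diff comp_rat_fam_mult comp_rat_fam_abs comp_rat_fam_divide_pow2
  comp_rat_fam_max

section \<open>Computable families of reals\<close>

lemma two_powr_minus_nat: "2 powr - real m = 1 / 2 ^ m"
  by (simp add: powr_minus powr_realpow divide_inverse)

lemma comp_real_fam_cong:
  assumes "\<And>xs. length xs = k \<Longrightarrow> f xs = g xs"
  shows "comp_real_fam k f \<longleftrightarrow> comp_real_fam k g"
  using assms by (simp add: comp_real_fam_def)

lemma comp_real_famE:
  assumes "comp_real_fam k x"
  obtains r where "comp_rat_fam (Suc k) r"
    "\<And>m xs. length xs = k \<Longrightarrow> \<bar>r (m # xs) - x xs\<bar> \<le> 1 / 2 ^ m"
  using assms unfolding comp_real_fam_def two_powr_minus_nat by blast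

lemma comp_real_famI:
  assumes "comp_rat_fam (Suc k) (\<lambda>ys. R (hd ys) (tl ys))"
    "\<And>m xs. length xs = k \<Longrightarrow> \<bar>R m xs - x xs\<bar> \<le> 1 / 2 ^ m"
  shows "comp_real_fam k x"
  unfolding comp_real_fam_def two_powr_minus_nat
  by (rule exI[of _ "\<lambda>ys. R (hd ys) (tl ys)"]) (use assms in auto)

lemma comp_real_fam_subst:
  assumes "comp_real_fam m F" "recursive_list k m G"
  shows "comp_real_fam k (\<lambda>xs. F (G xs))"
proof -
  obtain r where r: "comp_rat_fam (Suc m) r"
    "\<And>n xs. length xs = m \<Longrightarrow> \<bar>r (n # xs) - F xs\<bar> \<le> 1 / 2 ^ n"
    using comp_real_famE[OF assms(1)] by metis
  have G: "recursive_list (Suc k) m (\<lambda>ys. G (tl ys))"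
    unfolding recursive_list_def
  proof (intro conjI allI impI)
    show "recursive_on (Suc k) (\<lambda>ys. G (tl ys) ! i)" if "i < m" for i
      by (rule recursive_on_subst[OF recursive_on_list_nth[OF assms(2) that]] recursive_on_vars)+
  qed (use assms(2) in \<open>auto simp: recursive_list_def\<close>)
  have "comp_rat_fam (Suc k) (\<lambda>ys. r (hd ys # G (tl ys)))"
    by (rule comp_rat_fam_subst[OF r(1)] G recursive_on_vars)+
  then show ?thesis
    by (rule comp_real_famI) (use r(2) recursive_list_length[OF assms(2)] in auto)
qed

text \<open>A constant factor in the error is absorbed by reading the approximation \<open>c\<close>
  indices later, so later estimates may be generous by any fixed power of two.\<close>

lemma comp_real_fam_limit_rat:
  assumes "comp_rat_fam (Suc k) r" "\<And>m xs. length xs = k \<Longrightarrow> \<bar>r (m # xs) - x xs\<bar> \<le> 2 ^ c / 2 ^ m"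
  shows "comp_real_fam k x"
proof (rule comp_real_famI[where R = "\<lambda>m xs. r ((m + c) # xs)"])
  show "comp_rat_fam (Suc k) (\<lambda>ys. r ((hd ys + c) # tl ys))"
    by (rule comp_rat_fam_subst[OF assms(1)] recursive_on_add recursive_on_const recursive_on_vars)+
  show "\<bar>r ((m + c) # xs) - x xs\<bar> \<le> 1 / 2 ^ m" if "length xs = k" for m xs
    using assms(2)[OF that, of "m + c"] by (simp add: power_add)
qed

lemma comp_real_fam_limit:
  assumes y: "comp_real_fam (Suc k) y"
    and z: "\<And>n xs. length xs = k \<Longrightarrow> \<bar>y (n # xs) - z xs\<bar> \<le> 2 ^ c / 2 ^ n"
  shows "comp_real_fam k z"
proof -
  obtain r where r: "comp_rat_fam (Suc (Suc k)) r"
    "\<And>n xs. length xs = Suc k \<Longrightarrow> \<bar>r (n # xs) - y xs\<bar> \<le> 1 / 2 ^ n"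
    using comp_real_famE[OF y] by metis
  \<comment> \<open>Diagonal choice: the real at stage n is approximated with precision n, so one
    index controls both errors.\<close>
  have "comp_rat_fam (Suc k) (\<lambda>ys. r (hd ys # ys))"
    by (rule comp_rat_fam_subst[OF r(1)] recursive_on_vars)+
  then show ?thesis
  proof (rule comp_real_fam_limit_rat[where c = "Suc c"])
    fix m and xs :: "nat list" assume len: "length xs = k"
    have "\<bar>r (m # m # xs) - z xs\<bar> \<le> 1 / 2 ^ m + 2 ^ c / 2 ^ m"
      using r(2)[of "m # xs" m] z[OF len, of m] len by simp
    also have "\<dots> = (1 + 2 ^ c) / 2 ^ m" by (simp add: add_divide_distrib)
    also have "\<dots> \<le> 2 ^ Suc c / 2 ^ m" by (intro divide_right_mono) simp_all
    finally show "\<bar>r (hd (m # xs) # m # xs) - z xs\<bar> \<le> 2 ^ Suc c / 2 ^ m" by simp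
  qed
qed

lemma comp_real_fam_of_rat:
  assumes "comp_rat_fam k r" shows "comp_real_fam k r"
proof (rule comp_real_famI[where R = "\<lambda>m. r"])
  show "comp_rat_fam (Suc k) (\<lambda>ys. r (tl ys))"
    by (rule comp_rat_fam_subst[OF assms] recursive_on_vars)+
qed auto

lemma comp_real_fam_add:
  assumes "comp_real_fam k x" "comp_real_fam k y" shows "comp_real_fam k (\<lambda>xs. x xs + y xs)"
proof -
  obtain r where r: "comp_rat_fam (Suc k) r"
    "\<And>n xs. length xs = k \<Longrightarrow> \<bar>r (n # xs) - x xs\<bar> \<le> 1 / 2 ^ n"
    using comp_real_famE[OF assms(1)] by metis
  obtain s where s: "comp_rat_fam (Suc k) s"
    "\<And>n xs. length xs = k \<Longrightarrow> \<bar>s (n # xs) - y xs\<bar> \<le> 1 / 2 ^ n"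
    using comp_real_famE[OF assms(2)] by metis
  show ?thesis
  proof (rule comp_real_fam_limit_rat[where c = 1, OF comp_rat_fam_add[OF r(1) s(1)]])
    fix m and xs :: "nat list" assume "length xs = k"
    then show "\<bar>r (m # xs) + s (m # xs) - (x xs + y xs)\<bar> \<le> 2 ^ 1 / 2 ^ m"
      using order_trans[OF abs_diff_triangle_ineq add_mono[OF r(2) s(2)], of xs xs m m] by simp
  qed
qed

text \<open>The extra precision that compensates the factor \<open>w xs\<close> must itself be
  recursive in \<open>xs\<close>. A rational factor provides it: its size is at most the sum of the
  two naturals in its numerator, which serves as exponent \<open>B xs\<close>.\<close>

lemma comp_real_fam_mult_rat:
  assumes w: "comp_rat_fam k w" and x: "comp_real_fam k x"
  shows "comp_real_fam k (\<lambda>xs. w xs * x xs)"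
proof -
  obtain r where r: "comp_rat_fam (Suc k) r"
    "\<And>n xs. length xs = k \<Longrightarrow> \<bar>r (n # xs) - x xs\<bar> \<le> 1 / 2 ^ n"
    using comp_real_famE[OF x] by metis
  obtain p m b where *: "recursive_on k p" "recursive_on k m" "recursive_on k b"
    "\<And>xs. length xs = k \<Longrightarrow> b xs \<noteq> 0"
    "\<And>xs. length xs = k \<Longrightarrow> w xs = (real (p xs) - real (m xs)) / real (b xs)"
    using comp_rat_famE[OF w] by metis
  define B where "B xs = p xs + m xs" for xs
  have w_le: "\<bar>w xs\<bar> \<le> 2 ^ B xs" if "length xs = k" for xs
  proof -
    have "\<bar>w xs\<bar> \<le> \<bar>real (p xs) - real (m xs)\<bar> / 1"
      unfolding *(5)[OF that] abs_divide using *(4)[OF that] by (intro divide_left_mono) auto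
    also have "\<dots> \<le> real (B xs)" by (simp add: B_def)
    also have "\<dots> \<le> 2 ^ B xs"
      using of_nat_less_two_power[of "B xs", where 'a = real] by (rule less_imp_le)
    finally show ?thesis .
  qed
  have w': "comp_rat_fam (Suc k) (\<lambda>ys. w (tl ys))"
    by (rule comp_rat_fam_subst[OF w] recursive_on_vars)+
  have r': "comp_rat_fam (Suc k) (\<lambda>ys. r ((hd ys + B (tl ys)) # tl ys))"
    unfolding B_def
    by (rule comp_rat_fam_subst[OF r(1)] recursive_on_subst[OF *(1)] recursive_on_subst[OF *(2)]
        recursive_on_add recursive_on_vars)+
  show ?thesis
  proof (rule comp_real_famI[OF comp_rat_fam_mult[OF w' r']])
    fix n and xs :: "nat list" assume len: "length xs = k"
    have "\<bar>w xs\<bar> * \<bar>r ((n + B xs) # xs) - x xs\<bar> \<le> 2 ^ B xs * (1 / 2 ^ (n + B xs))"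
      by (intro mult_mono w_le r len) auto
    then show "\<bar>w xs * r ((n + B xs) # xs) - w xs * x xs\<bar> \<le> 1 / 2 ^ n"
      by (simp flip: abs_mult right_diff_distrib add: power_add)
  qed
qed

lemma comp_real_fam_uminus:
  assumes "comp_real_fam k x" shows "comp_real_fam k (\<lambda>xs. - x xs)"
  using comp_real_fam_mult_rat[OF comp_rat_fam_uminus[OF comp_rat_fam_1] assms] by simp

lemma comp_real_fam_diff:
  assumes "comp_real_fam k x" "comp_real_fam k y" shows "comp_real_fam k (\<lambda>xs. x xs - y xs)"
  using comp_real_fam_add[OF assms(1) comp_real_fam_uminus[OF assms(2)]] by simp

lemma comp_real_fam_abs:
  assumes "comp_real_fam k x" shows "comp_real_fam k (\<lambda>xs. \<bar>x xs\<bar>)"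
proof -
  obtain r where r: "comp_rat_fam (Suc k) r"
    "\<And>n xs. length xs = k \<Longrightarrow> \<bar>r (n # xs) - x xs\<bar> \<le> 1 / 2 ^ n"
    using comp_real_famE[OF assms(1)] by metis
  show ?thesis
    by (rule comp_real_fam_limit_rat[where c = 0, OF comp_rat_fam_abs[OF r(1)]])
       (use r(2) in \<open>force intro: order_trans[OF abs_triangle_ineq3]\<close>)
qed

lemma comp_real_fam_sum:
  assumes F: "comp_real_fam (Suc k) (\<lambda>ys. F (hd ys) (tl ys))" and N: "recursive_on k N"
  shows "comp_real_fam k (\<lambda>xs. \<Sum>i<N xs. F i xs)"
proof -
  obtain r where r: "comp_rat_fam (Suc (Suc k)) r"
    "\<And>n xs. length xs = Suc k \<Longrightarrow> \<bar>r (n # xs) - F (hd xs) (tl xs)\<bar> \<le> 1 / 2 ^ n"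
    using comp_real_famE[OF F] by metis
  \<comment> \<open>Reading each summand with precision \<open>m + N xs\<close> keeps the total
    error below (N / 2^N) 2^-m, hence below 2^-m.\<close>
  define R where "R m xs = (\<Sum>i<N xs. r ((m + N xs) # i # xs))" for m xs
  have rN: "recursive_on (Suc k) (\<lambda>ys. N (tl ys))" "recursive_on (Suc (Suc k)) (\<lambda>ys. N (tl (tl ys)))"
    by (rule recursive_on_subst[OF N] recursive_on_vars)+
  show ?thesis
  proof (rule comp_real_famI[where R = R])
    show "comp_rat_fam (Suc k) (\<lambda>ys. R (hd ys) (tl ys))" unfolding R_def
    proof (rule comp_rat_fam_sum[OF _ rN(1)])
      show "comp_rat_fam (Suc (Suc k)) (\<lambda>ys. r ((hd (tl ys) + N (tl (tl ys))) # hd ys # tl (tl ys)))"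
        by (rule comp_rat_fam_subst[OF r(1)] rN recursive_on_add recursive_on_vars)+
    qed
    fix m and xs :: "nat list" assume len: "length xs = k"
    have "\<bar>R m xs - (\<Sum>i<N xs. F i xs)\<bar> \<le> (\<Sum>i<N xs. 1 / 2 ^ (m + N xs))"
      unfolding R_def sum_subtractf[symmetric]
    proof (intro order_trans[OF sum_abs] sum_mono)
      fix i show "\<bar>r ((m + N xs) # i # xs) - F i xs\<bar> \<le> 1 / 2 ^ (m + N xs)"
        using r(2)[of "i # xs" "m + N xs"] len by simp
    qed
    also have "\<dots> = (real (N xs) / 2 ^ N xs) / 2 ^ m" by (simp add: power_add)
    also have "\<dots> \<le> 1 / 2 ^ m"
    proof (intro divide_right_mono)
      show "real (N xs) / 2 ^ N xs \<le> 1"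
        using of_nat_less_two_power[of "N xs", where 'a = real] by (simp add: less_imp_le)
    qed simp
    finally show "\<bar>R m xs - (\<Sum>i<N xs. F i xs)\<bar> \<le> 1 / 2 ^ m" .
  qed
qed

lemma computable_real_iff: "computable_real x \<longleftrightarrow> comp_real_fam 0 (\<lambda>_. x)"
proof
  assume "computable_real x"
  then obtain r where r: "comp_rat_seq r" "\<And>n. \<bar>x - r n\<bar> < 1 / 2 ^ n"
    unfolding computable_real_def two_powr_minus_nat by blast
  show "comp_real_fam 0 (\<lambda>_. x)"
  proof (rule comp_real_famI[where R = "\<lambda>m xs. r m"])
    show "comp_rat_fam (Suc 0) (\<lambda>ys. r (hd ys))"
      using r(1) unfolding comp_rat_seq_def
      by (subst comp_rat_fam_cong[where g = "\<lambda>ys. r (ys ! 0)"]) (auto simp: length_Suc_conv)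
    show "\<bar>r m - x\<bar> \<le> 1 / 2 ^ m" for m using r(2)[of m] by (simp add: abs_minus_commute)
  qed
next
  assume "comp_real_fam 0 (\<lambda>_. x)"
  then obtain r where r: "comp_rat_fam (Suc 0) r"
    "\<And>n xs. xs = [] \<Longrightarrow> \<bar>r (n # xs) - x\<bar> \<le> 1 / 2 ^ n"
    by (elim comp_real_famE) auto
  show "computable_real x" unfolding computable_real_def two_powr_minus_nat
  proof (intro exI conjI allI)
    \<comment> \<open>The family gives a weak error bound and \<open>computable_real\<close> asks
      for a strict one; reading one index later closes the gap.\<close>
    show "comp_rat_seq (\<lambda>n. r [Suc n])"
      unfolding comp_rat_seq_def One_nat_def
      by (rule comp_rat_fam_subst[OF r(1)] recursive_on_Suc recursive_on_nth recursive_on_vars lessI)+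
    show "\<bar>x - r [Suc n]\<bar> < 1 / 2 ^ n" for n
      using r(2)[of "[]" "Suc n"] by (simp add: abs_minus_commute field_simps)
  qed
qed

lemma comp_real_fam_const: "computable_real x \<Longrightarrow> comp_real_fam k (\<lambda>_. x)"
  unfolding computable_real_iff
  by (drule comp_real_fam_subst[OF _ recursive_list_Nil]) simp

lemma computable_real_diff: "computable_real x \<Longrightarrow> computable_real y \<Longrightarrow> computable_real (x - y)"
  unfolding computable_real_iff by (rule comp_real_fam_diff)

lemma computable_real_uminus: "computable_real x \<Longrightarrow> computable_real (- x)"
  unfolding computable_real_iff by (rule comp_real_fam_uminus)

section \<open>Logarithms\<close>

text \<open>Counting the powers 2, 4, 8, ... up to \<open>n\<close> in a sum of fixed range makes
  recursiveness immediate. The value at 0 is 0.\<close>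

definition floor_log2 :: "nat \<Rightarrow> nat" where
  "floor_log2 n = (\<Sum>j<n. if 2 ^ Suc j \<le> n then 1 else 0)"

lemma floor_log2_bounds:
  assumes "n > 0" shows "2 ^ floor_log2 n \<le> n" "n < 2 ^ Suc (floor_log2 n)"
proof -
  obtain k where k: "2 ^ k \<le> n" "n < 2 ^ Suc k"
    using ex_power_ivl1[of 2 n] assms by auto
  \<comment> \<open>The range of the sum is long enough to count all \<open>k\<close>
    powers.\<close>
  have "k < n" using k(1) less_exp[of k] by linarith
  have "2 ^ Suc j \<le> n \<longleftrightarrow> j < k" for j
  proof
    assume "2 ^ Suc j \<le> n"
    then have "(2::nat) ^ Suc j < 2 ^ Suc k" using k(2) by (rule le_less_trans)
    then show "j < k" by (simp only: power_strict_increasing_iff)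
  next
    assume "j < k"
    then have "(2::nat) ^ Suc j \<le> 2 ^ k" by (intro power_increasing) auto
    then show "2 ^ Suc j \<le> n" using k(1) by linarith
  qed
  then have "floor_log2 n = (\<Sum>j<n. if j < k then 1 else 0)" by (simp add: floor_log2_def)
  also have "\<dots> = card {j\<in>{..<n}. j < k}" by (subst sum.inter_filter[symmetric]) auto
  also have "{j\<in>{..<n}. j < k} = {..<k}" using \<open>k < n\<close> by auto
  finally show "2 ^ floor_log2 n \<le> n" "n < 2 ^ Suc (floor_log2 n)" using k by auto
qed

lemma recursive_on_floor_log2:
  assumes "recursive_on k f" shows "recursive_on k (\<lambda>xs. floor_log2 (f xs))"
proof -
  have f': "recursive_on (Suc k) (\<lambda>xs. f (tl xs))"
    by (rule recursive_on_subst[OF assms] recursive_on_vars)+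
  show ?thesis unfolding floor_log2_def
    by (rule recursive_on_sum recursive_on_if_le recursive_on_power recursive_on_Suc assms f'
        recursive_on_const recursive_on_vars)+
qed

text \<open>Logarithms of naturals to any precision by counting powers of two below \<^term>\<open>a ^ N\<close>.\<close>
lemma log2_approx:
  assumes "a > 0" "N > 0"
  shows "\<bar>real (floor_log2 (a ^ N)) / real N - log 2 (real a)\<bar> \<le> 1 / real N"
proof -
  let ?l = "floor_log2 (a ^ N)"
  have "2 ^ ?l \<le> a ^ N" "a ^ N < 2 ^ Suc ?l"
    using floor_log2_bounds[of "a ^ N"] assms by auto
  then have "(2::real) ^ ?l \<le> real a ^ N" "real a ^ N \<le> 2 ^ Suc ?l"
    by (metis of_nat_le_iff of_nat_numeral of_nat_power less_imp_le)+
  then have "log 2 (2 ^ ?l) \<le> log 2 (real a ^ N)" "log 2 (real a ^ N) \<le> log 2 (2 ^ Suc ?l)"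
    using assms by (subst log_le_cancel_iff; simp)+
  then have "real ?l \<le> real N * log 2 (real a)" "real N * log 2 (real a) \<le> real (Suc ?l)"
    using assms by (simp_all add: log_nat_power del: power_Suc)
  then have "\<bar>real ?l - real N * log 2 (real a)\<bar> / real N \<le> 1 / real N"
    by (intro divide_right_mono) auto
  also have "\<bar>real ?l - real N * log 2 (real a)\<bar> / real N =
      \<bar>(real ?l - real N * log 2 (real a)) / real N\<bar>" by simp
  finally show ?thesis using assms by (simp add: diff_divide_distrib)
qed

lemma comp_real_fam_log_rat:
  assumes r: "comp_rat_fam k r" and pos: "\<And>xs. length xs = k \<Longrightarrow> r xs > 0"
  shows "comp_real_fam k (\<lambda>xs. log 2 (r xs))"
proof -
  obtain p m b where *: "recursive_on k p" "recursive_on k m" "recursive_on k b"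
    and b: "\<And>xs. length xs = k \<Longrightarrow> b xs \<noteq> 0"
    and eq: "\<And>xs. length xs = k \<Longrightarrow> r xs = (real (p xs) - real (m xs)) / real (b xs)"
    using comp_rat_famE[OF r] by metis
  \<comment> \<open>Positivity of \<open>r\<close> makes this truncated difference the exact
    numerator.\<close>
  define a where "a xs = p xs - m xs" for xs
  \<comment> \<open>Exponent 2^n in \<open>log2_approx\<close> gives an error of at most 2^-n for
    each of the two logarithms.\<close>
  define R where "R n xs = (real (floor_log2 (a xs ^ (2 ^ n))) - real (floor_log2 (b xs ^ (2 ^ n)))) / 2 ^ n"
    for n xs
  have a': "recursive_on (Suc k) (\<lambda>ys. a (tl ys))"
    unfolding a_def by (rule recursive_on_diff recursive_on_subst[OF *(1)] recursive_on_subst[OF *(2)] recursive_on_vars)+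
  have b': "recursive_on (Suc k) (\<lambda>ys. b (tl ys))"
    by (rule recursive_on_subst[OF *(3)] recursive_on_vars)+
  show ?thesis
  proof (rule comp_real_fam_limit_rat[where c = 1])
    show "comp_rat_fam (Suc k) (\<lambda>ys. R (hd ys) (tl ys))" unfolding R_def
      by (rule comp_rat_fam_intros recursive_on_floor_log2 recursive_on_power a' b'
          recursive_on_const recursive_on_vars)+
    fix n and xs :: "nat list" assume len: "length xs = k"
    have "a xs > 0" "real (a xs) = real (p xs) - real (m xs)"
      using pos[OF len] eq[OF len] b[OF len] by (auto simp: a_def zero_less_divide_iff)
    then have "log 2 (r xs) = log 2 (real (a xs)) - log 2 (real (b xs))"
      using eq[OF len] b[OF len] by (simp add: log_divide)
    moreover have "\<bar>real (floor_log2 (a xs ^ (2 ^ n))) / 2 ^ n - log 2 (real (a xs))\<bar> \<le> 1 / 2 ^ n"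
      "\<bar>real (floor_log2 (b xs ^ (2 ^ n))) / 2 ^ n - log 2 (real (b xs))\<bar> \<le> 1 / 2 ^ n"
      using log2_approx[of _ "2 ^ n"] \<open>a xs > 0\<close> b[OF len] by simp_all
    ultimately show "\<bar>R (hd (n # xs)) (tl (n # xs)) - log 2 (r xs)\<bar> \<le> 2 ^ 1 / 2 ^ n"
      unfolding R_def by (simp add: diff_divide_distrib abs_diff_le_iff abs_le_iff)
  qed
qed

lemma log2_Lipschitz:
  fixes x y \<delta> :: real
  assumes "\<delta> > 0" "x \<ge> \<delta>" "y \<ge> \<delta>"
  shows "\<bar>log 2 x - log 2 y\<bar> \<le> 2 * \<bar>x - y\<bar> / \<delta>"
proof -
  have *: "log 2 x - log 2 y \<le> 2 * \<bar>x - y\<bar> / \<delta>" if "x \<ge> \<delta>" "y \<ge> \<delta>" for x y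
  proof -
    have pos: "x > 0" "y > 0" using that \<open>\<delta> > 0\<close> by auto
    \<comment> \<open>The factor 2 in the claim is this bound on 1 / ln 2.\<close>
    have ln2: "ln 2 \<ge> (1/2 :: real)" using ln2_ge_two_thirds by simp
    have "ln (x / y) \<le> x / y - 1" using pos by (intro ln_le_minus_one) simp
    also have "\<dots> = (x - y) / y" using pos by (simp add: field_simps)
    also have "\<dots> \<le> \<bar>x - y\<bar> / \<delta>" using that pos assms(1) by (intro frac_le) auto
    finally have le: "ln (x / y) \<le> \<bar>x - y\<bar> / \<delta>" .
    have "log 2 x - log 2 y = ln (x / y) / ln 2"
      using pos by (simp add: log_def ln_div diff_divide_distrib)
    also have "\<dots> \<le> (\<bar>x - y\<bar> / \<delta>) / ln 2"
      using le by (intro divide_right_mono) auto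
    also have "\<dots> \<le> (\<bar>x - y\<bar> / \<delta>) / (1/2)"
      using assms(1) ln2 by (intro divide_left_mono) auto
    finally show ?thesis by (simp add: mult.commute)
  qed
  show ?thesis using *[of x y] *[of y x] assms by (auto simp: abs_le_iff abs_minus_commute)
qed

text \<open>Rational approximations of a positive real may be negative or too close to 0. Clipping
  them at the common lower bound 1 / 2^c keeps them where log2 is Lipschitz, and it does not
  increase the error because \<open>x xs\<close> lies above that bound.\<close>

lemma comp_real_fam_log:
  assumes x: "comp_real_fam k x" and ge: "\<And>xs. length xs = k \<Longrightarrow> x xs \<ge> 1 / 2 ^ c"
  shows "comp_real_fam k (\<lambda>xs. log 2 (x xs))"
proof -
  obtain r where r: "comp_rat_fam (Suc k) r"
    "\<And>n xs. length xs = k \<Longrightarrow> \<bar>r (n # xs) - x xs\<bar> \<le> 1 / 2 ^ n"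
    using comp_real_famE[OF x] by metis
  have "comp_real_fam (Suc k) (\<lambda>ys. log 2 (max (r ys) (1 / 2 ^ c)))"
    by (rule comp_real_fam_log_rat comp_rat_fam_intros r recursive_on_const)+ (simp add: less_max_iff_disj)
  then show ?thesis
  proof (rule comp_real_fam_limit[where c = "Suc c"])
    fix n and xs :: "nat list" assume len: "length xs = k"
    let ?y = "max (r (n # xs)) (1 / 2 ^ c)"
    have "\<bar>log 2 ?y - log 2 (x xs)\<bar> \<le> 2 * \<bar>?y - x xs\<bar> / (1 / 2 ^ c)"
      using ge[OF len] by (intro log2_Lipschitz) auto
    also have "\<dots> \<le> 2 * (1 / 2 ^ n) / (1 / 2 ^ c)"
      using r(2)[OF len, of n] ge[OF len] by (intro divide_right_mono mult_left_mono) (auto simp: max_def)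
    finally show "\<bar>log 2 ?y - log 2 (x xs)\<bar> \<le> 2 ^ Suc c / 2 ^ n" by simp
  qed
qed

section \<open>Sequences and unary functions as families with one argument\<close>

lemma comp_rat_seq_app:
  assumes "comp_rat_seq r" "recursive_on k f" shows "comp_rat_fam k (\<lambda>xs. r (f xs))"
  using comp_rat_fam_subst[of 1 "\<lambda>xs. r (xs ! 0)" k "\<lambda>xs. [f xs]"] assms
  by (simp add: comp_rat_seq_def recursive_list_Cons recursive_list_Nil)

lemma comp_rat_seqI: "comp_rat_fam (Suc 0) (\<lambda>xs. r (hd xs)) \<Longrightarrow> comp_rat_seq r"
  unfolding comp_rat_seq_def
  by (subst comp_rat_fam_cong[where g = "\<lambda>xs. r (hd xs)"]) (auto simp: length_Suc_conv)

lemma recursive_app: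
  assumes "recursive A" "recursive_on k f" shows "recursive_on k (\<lambda>xs. A (f xs))"
  using recursive_on_subst[of 1 "\<lambda>xs. A (xs ! 0)" k "\<lambda>xs. [f xs]"] assms
  by (simp add: recursive_def recursive_list_Cons recursive_list_Nil)

lemma recursiveI: "recursive_on (Suc 0) (\<lambda>xs. A (hd xs)) \<Longrightarrow> recursive A"
  unfolding recursive_def
  by (subst recursive_on_cong[where g = "\<lambda>xs. A (hd xs)"]) (auto simp: length_Suc_conv)

lemma comp_real_seq_app:
  assumes "comp_real_seq x" "recursive_on k f" shows "comp_real_fam k (\<lambda>xs. x (f xs))"
  using comp_real_fam_subst[of 1 "\<lambda>xs. x (xs ! 0)" k "\<lambda>xs. [f xs]"] assms
  by (simp add: comp_real_seq_def recursive_list_Cons recursive_list_Nil)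

section \<open>Effective series and integrals\<close>

lemma suminf_geometric_bound:
  fixes f :: "nat \<Rightarrow> real"
  assumes "\<And>i. \<bar>f i\<bar> \<le> C / 2 ^ i"
  shows "summable f" "\<bar>suminf f - (\<Sum>i<n. f i)\<bar> \<le> 2 * C / 2 ^ n"
proof -
  have geo: "(\<lambda>i. C / 2 ^ n * (1 / 2) ^ i) sums (C / 2 ^ n * 2)" for n
    using sums_mult[OF geometric_sums[of "1/2 :: real"], of "C / 2 ^ n"] by simp
  have geo0: "summable (\<lambda>i. C / 2 ^ i)"
    using sums_summable[OF geo[of 0]] by (simp add: power_one_over)
  show sf: "summable f"
    by (rule summable_comparison_test'[OF geo0, of 0]) (use assms in auto)
  have le: "\<bar>f (i + n)\<bar> \<le> C / 2 ^ n * (1 / 2) ^ i" for i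
  proof -
    have "C / 2 ^ (i + n) = C / 2 ^ n * (1 / 2) ^ i" by (simp add: power_add power_one_over)
    then show ?thesis using assms[of "i + n"] by (simp only:)
  qed
  have "summable (\<lambda>i. \<bar>f (i + n)\<bar>)"
    by (rule summable_comparison_test'[OF sums_summable[OF geo[of n]], of 0]) (use le in auto)
  then have "\<bar>\<Sum>i. f (i + n)\<bar> \<le> (\<Sum>i. \<bar>f (i + n)\<bar>)" "(\<Sum>i. \<bar>f (i + n)\<bar>) \<le> C / 2 ^ n * 2"
    by (rule summable_rabs, rule sums_le[OF le summable_sums geo])
  moreover have "suminf f - (\<Sum>i<n. f i) = (\<Sum>i. f (i + n))"
    using suminf_split_initial_segment[OF sf, of n] by simp
  ultimately show "\<bar>suminf f - (\<Sum>i<n. f i)\<bar> \<le> 2 * C / 2 ^ n" by (simp add: mult.commute[of C])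
qed

text \<open>Domination by a geometric series, uniformly in the parameters, gives the partial sums a
  known rate of convergence.\<close>

lemma comp_real_fam_suminf:
  assumes F: "comp_real_fam (Suc k) (\<lambda>ys. F (hd ys) (tl ys))"
    and le: "\<And>i xs. length xs = k \<Longrightarrow> \<bar>F i xs\<bar> \<le> 2 ^ c / 2 ^ i"
  shows "comp_real_fam k (\<lambda>xs. \<Sum>i. F i xs)"
proof -
  \<comment> \<open>The list is term index, number of terms, parameters; the number of terms is
    dropped before \<open>F\<close> is applied.\<close>
  have "recursive_list (Suc (Suc k)) (Suc k) (\<lambda>ys. hd ys # tl (tl ys))"
    by (rule recursive_on_vars)+
  from comp_real_fam_subst[OF F this]
  have "comp_real_fam (Suc (Suc k)) (\<lambda>ys. F (hd ys) (tl (tl ys)))"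
    by (simp only: list.sel)
  then have "comp_real_fam (Suc k) (\<lambda>ys. \<Sum>i<hd ys. F i (tl ys))"
    by (rule comp_real_fam_sum[where F = "\<lambda>i xs. F i (tl xs)"]) (rule recursive_on_vars)+
  then show ?thesis
  proof (rule comp_real_fam_limit[where c = "Suc c"])
    fix n and xs :: "nat list" assume "length xs = k"
    then have "\<bar>(\<Sum>i. F i xs) - (\<Sum>i<n. F i xs)\<bar> \<le> 2 * 2 ^ c / 2 ^ n"
      by (intro suminf_geometric_bound(2) le)
    then show "\<bar>(\<Sum>i<hd (n # xs). F i (tl (n # xs))) - (\<Sum>i. F i xs)\<bar> \<le> 2 ^ Suc c / 2 ^ n"
      by (simp only: list.sel power_Suc abs_minus_commute[of "suminf _"])
  qed
qed

text \<open>On a cell of length 1/n the function moves by at most L/n, which costs L/n^2. The proof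
  adds up the first \<open>m\<close> cells of the fixed mesh.\<close>

lemma Riemann_sum_error:
  fixes h :: "real \<Rightarrow> real"
  assumes Lip: "L-lipschitz_on {0..1} h" and n: "n > 0"
  shows "\<bar>(\<Sum>i<n. h (real i / real n)) / real n - integral {0..1} h\<bar> \<le> L / real n"
proof -
  have cont: "continuous_on {0..1} h" using Lip by (rule lipschitz_on_continuous_on)
  have io: "h integrable_on {a..b}" if "0 \<le> a" "b \<le> 1" for a b
    by (intro integrable_continuous_real continuous_on_subset[OF cont]) (use that in auto)
  have "\<bar>(\<Sum>i<m. h (real i / real n)) / real n - integral {0..real m / real n} h\<bar> \<le> real m * (L / (real n)\<^sup>2)"
    if "m \<le> n" for m
    using that
  proof (induction m)
    case (Suc m)
    let ?a = "real m / real n" and ?b = "real (Suc m) / real n"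
    have ab: "0 \<le> ?a" "?a \<le> ?b" "?b \<le> 1" "?b - ?a = 1 / real n"
      using Suc.prems n by (auto simp: field_simps)
    have "integral {0..?b} h = integral {0..?a} h + integral {?a..?b} h"
      by (subst Henstock_Kurzweil_Integration.integral_combine[OF ab(1,2)]) (use io ab in auto)
    moreover have "\<bar>integral {?a..?b} h - h ?a / real n\<bar> \<le> L / (real n)\<^sup>2"
    proof -
      have "((\<lambda>x. h x - h ?a) has_integral integral {?a..?b} h - h ?a / real n) (cbox ?a ?b)"
        using has_integral_diff[OF integrable_integral[OF io] has_integral_const_real[of "h ?a" ?a ?b]] ab
        by (simp add: content_real)
      then have "norm (integral {?a..?b} h - h ?a / real n) \<le> L / real n * measure lborel (cbox ?a ?b)"
      proof (rule has_integral_bound[rotated])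
        have "L \<ge> 0" using Lip by (rule lipschitz_on_nonneg)
        then show "0 \<le> L / real n" by simp
        fix x assume x: "x \<in> cbox ?a ?b"
        then have "?a \<le> x" by simp
        then have "0 \<le> x" by (rule order_trans[OF ab(1)])
        then have "dist (h x) (h ?a) \<le> L * dist x ?a"
          using x ab by (intro lipschitz_onD[OF Lip]) auto
        also have "\<dots> \<le> L * (1 / real n)"
          using x ab \<open>L \<ge> 0\<close> by (intro mult_left_mono) (auto simp: dist_real_def)
        finally show "norm (h x - h ?a) \<le> L / real n" by (simp add: dist_norm)
      qed
      then show ?thesis using ab by (simp add: content_real power2_eq_square)
    qed
    moreover have "(\<Sum>i<Suc m. h (real i / real n)) / real n =
        (\<Sum>i<m. h (real i / real n)) / real n + h ?a / real n"
      by (simp add: add_divide_distrib)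
    moreover have "real (Suc m) * (L / (real n)\<^sup>2) = real m * (L / (real n)\<^sup>2) + L / (real n)\<^sup>2"
      by (simp add: distrib_right del: times_divide_eq_right)
    moreover have "\<bar>(\<Sum>i<m. h (real i / real n)) / real n - integral {0..?a} h\<bar> \<le> real m * (L / (real n)\<^sup>2)"
      using Suc by simp
    ultimately show ?case by linarith
  qed simp
  from this[of n] have "\<bar>(\<Sum>i<n. h (real i / real n)) / real n - integral {0..1} h\<bar> \<le> real n * (L / (real n)\<^sup>2)"
    using n by simp
  also have "\<dots> = L / real n" using n by (simp add: power2_eq_square)
  finally show ?thesis .
qed

text \<open>Values at dyadic nodes are enough: the list starts with the node number and the level,
  giving the node i / 2^n. A Lipschitz constant common to all parameters makes the error of the sums
  effective.\<close>

lemma comp_real_fam_integral: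
  assumes h: "comp_real_fam (Suc (Suc k)) (\<lambda>ys. h (tl (tl ys)) (real (hd ys) / 2 ^ hd (tl ys)))"
    and Lip: "\<And>xs. length xs = k \<Longrightarrow> (2 ^ c)-lipschitz_on {0..1} (h xs)"
  shows "comp_real_fam k (\<lambda>xs. integral {0..1} (h xs))"
proof -
  have "comp_real_fam (Suc k) (\<lambda>ys. \<Sum>i<2 ^ hd ys. h (tl ys) (real i / 2 ^ hd ys))"
    by (rule comp_real_fam_sum[where F = "\<lambda>i xs. h (tl xs) (real i / 2 ^ hd xs)", OF h]) (rule recursive_on_power recursive_on_const recursive_on_vars)+
  moreover have "comp_rat_fam (Suc k) (\<lambda>ys. 1 / 2 ^ hd ys)"
    by (rule comp_rat_fam_intros recursive_on_vars)+
  ultimately have "comp_real_fam (Suc k) (\<lambda>ys. 1 / 2 ^ hd ys * (\<Sum>i<2 ^ hd ys. h (tl ys) (real i / 2 ^ hd ys)))"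
    by (intro comp_real_fam_mult_rat)
  then show ?thesis
  proof (rule comp_real_fam_limit[where c = c])
    fix n and xs :: "nat list" assume "length xs = k"
    from Riemann_sum_error[OF Lip[OF this], of "2 ^ n"]
    show "\<bar>1 / 2 ^ hd (n # xs) * (\<Sum>i<2 ^ hd (n # xs). h (tl (n # xs)) (real i / 2 ^ hd (n # xs))) -
        integral {0..1} (h xs)\<bar> \<le> 2 ^ c / 2 ^ n"
      by simp
  qed
qed

section \<open>The classes Sigma1, Pi1 and Delta2\<close>

lemma computable_real_incseq:
  assumes "computable_real u"
  obtains r where "comp_rat_seq r" "incseq r" "r \<longlonglongrightarrow> u"
proof -
  obtain q where q: "comp_rat_seq q" "\<And>n. \<bar>u - q n\<bar> < 1 / 2 ^ n"
    using assms unfolding computable_real_def two_powr_minus_nat by blast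
  \<comment> \<open>Consecutive \<open>q\<close> drop by less than 2^-n + 2^-(n+1), which is exactly
    what the shrinking of 3 / 2^n to 3 / 2^(n+1) makes up for.\<close>
  define r where "r n = q n - 3 / 2 ^ n" for n
  have "comp_rat_seq r" unfolding r_def
    by (rule comp_rat_seqI) (rule comp_rat_fam_intros comp_rat_seq_app[OF q(1)] recursive_on_vars)+
  moreover have "incseq r"
  proof (rule incseq_SucI)
    show "r n \<le> r (Suc n)" for n
      using q(2)[of n] q(2)[of "Suc n"] unfolding r_def by (simp add: abs_less_iff)
  qed
  moreover have "r \<longlonglongrightarrow> u"
  proof (rule LIMSEQ_I)
    have "(\<lambda>n. 4 * (1 / 2 :: real) ^ n) \<longlonglongrightarrow> 4 * 0"
      by (intro tendsto_intros LIMSEQ_realpow_zero) auto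
    moreover fix e :: real assume "0 < e"
    ultimately obtain N where N: "\<And>n. n \<ge> N \<Longrightarrow> 4 * (1 / 2 :: real) ^ n < e"
      using LIMSEQ_D[of "\<lambda>n. 4 * (1 / 2 :: real) ^ n" 0 e] by auto
    show "\<exists>N. \<forall>n\<ge>N. norm (r n - u) < e"
    proof (intro exI allI impI)
      fix n assume "n \<ge> N"
      have "\<bar>r n - u\<bar> < 4 / 2 ^ n" using q(2)[of n] unfolding r_def by (simp add: abs_less_iff)
      also have "\<dots> < e" using N[OF \<open>n \<ge> N\<close>] by (simp add: power_one_over)
      finally show "norm (r n - u) < e" by simp
    qed
  qed
  ultimately show ?thesis by (rule that)
qed

lemma Sigma1_add_computable:
  assumes "x \<in> Sigma1" "computable_real u" shows "x + u \<in> Sigma1"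
proof -
  obtain r where r: "comp_rat_seq r" "incseq r" "r \<longlonglongrightarrow> x"
    using assms(1) by (auto simp: Sigma1_def)
  obtain q where q: "comp_rat_seq q" "incseq q" "q \<longlonglongrightarrow> u"
    using computable_real_incseq[OF assms(2)] .
  have "comp_rat_seq (\<lambda>n. r n + q n)"
    by (rule comp_rat_seqI)
       (rule comp_rat_fam_add comp_rat_seq_app[OF r(1)] comp_rat_seq_app[OF q(1)] recursive_on_vars)+
  moreover have "incseq (\<lambda>n. r n + q n)" using r(2) q(2) by (auto simp: mono_def add_mono)
  ultimately show ?thesis using r(3) q(3) by (auto simp: Sigma1_def intro: tendsto_add)
qed

lemma comp_rat_seq_uminus: "comp_rat_seq r \<Longrightarrow> comp_rat_seq (\<lambda>n. - r n)"
  unfolding comp_rat_seq_def by (rule comp_rat_fam_uminus)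

lemma Pi1_iff_uminus: "x \<in> Pi1 \<longleftrightarrow> - x \<in> Sigma1"
proof
  assume "x \<in> Pi1"
  then obtain r where "comp_rat_seq r" "decseq r" "r \<longlonglongrightarrow> x" by (auto simp: Pi1_def)
  then show "- x \<in> Sigma1"
    by (auto simp: Sigma1_def monotone_def intro!: exI[of _ "\<lambda>n. - r n"] comp_rat_seq_uminus tendsto_minus)
next
  assume "- x \<in> Sigma1"
  then obtain r where "comp_rat_seq r" "incseq r" "r \<longlonglongrightarrow> - x" by (auto simp: Sigma1_def)
  then show "x \<in> Pi1"
    by (auto simp: Pi1_def monotone_def tendsto_minus_cancel_left
        intro!: exI[of _ "\<lambda>n. - r n"] comp_rat_seq_uminus)
qed

lemma Sigma1_add_computable_iff: "computable_real u \<Longrightarrow> x + u \<in> Sigma1 \<longleftrightarrow> x \<in> Sigma1"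
  using Sigma1_add_computable[of x u] Sigma1_add_computable[of "x + u" "- u"]
  by (auto simp: computable_real_uminus)

lemma Pi1_add_computable_iff: "computable_real u \<Longrightarrow> x + u \<in> Pi1 \<longleftrightarrow> x \<in> Pi1"
  using Sigma1_add_computable_iff[of "- u" "- x"] by (simp add: Pi1_iff_uminus computable_real_uminus)

lemma Delta2_add_computable:
  assumes "x \<in> Delta2" "computable_real u" shows "x + u \<in> Delta2"
proof -
  obtain a b where "a \<in> Sigma1" "b \<in> Sigma1" "x = a - b" using assms(1) by (auto simp: Delta2_def)
  moreover have "a + u \<in> Sigma1" using \<open>a \<in> Sigma1\<close> assms(2) by (rule Sigma1_add_computable)
  ultimately show ?thesis unfolding Delta2_def by force
qed

section \<open>Dyadic bumps\<close>

text \<open>A triangular probability density on [0, 1] of height 2 and slopes 4 and -4. It is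
  piecewise linear with rational data, so it maps rationals to rationals.\<close>

definition tent :: "real \<Rightarrow> real" where
  "tent t = max 0 (2 - 4 * \<bar>t - 1 / 2\<bar>)"

definition bump :: "nat \<Rightarrow> real \<Rightarrow> real" where
  "bump n \<alpha> = tent (\<alpha> / 2 ^ n - 1) / 2 ^ n"

text \<open>The expectation of \<open>G\<close> under the density \<open>bump n\<close>, pulled back
  by the substitution 2^n (1 + t) to an interval that does not depend on \<open>n\<close>.\<close>

definition bump_mean :: "(real \<Rightarrow> real) \<Rightarrow> nat \<Rightarrow> real" where
  "bump_mean G n = integral {0..1} (\<lambda>t. G (2 ^ n * (1 + t)) * tent t)"

lemma tent_nonneg: "0 \<le> tent t" and tent_le: "tent t \<le> 2"
  and tent_outside: "t \<notin> {0..1} \<Longrightarrow> tent t = 0"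
  unfolding tent_def by auto

lemma tent_Lipschitz: "\<bar>tent x - tent y\<bar> \<le> 4 * \<bar>x - y\<bar>"
proof -
  have max0: "\<bar>max 0 p - max 0 q\<bar> \<le> \<bar>p - q\<bar>" for p q :: real
    by (simp add: max_def)
  have "\<bar>tent x - tent y\<bar> \<le> \<bar>(2 - 4 * \<bar>x - 1 / 2\<bar>) - (2 - 4 * \<bar>y - 1 / 2\<bar>)\<bar>"
    unfolding tent_def by (rule max0)
  also have "(2 - 4 * \<bar>x - 1 / 2\<bar>) - (2 - 4 * \<bar>y - 1 / 2\<bar>) = 4 * (\<bar>y - 1 / 2\<bar> - \<bar>x - 1 / 2\<bar>)"
    by simp
  also have "\<bar>\<dots>\<bar> \<le> 4 * \<bar>x - y\<bar>"
    using abs_triangle_ineq3[of "y - 1 / 2" "x - 1 / 2"] by (simp only: abs_mult abs_minus_commute[of y]) simp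
  finally show ?thesis .
qed

lemma continuous_on_tent [continuous_intros]:
  "continuous_on X f \<Longrightarrow> continuous_on X (\<lambda>x. tent (f x))"
  unfolding tent_def by (intro continuous_intros)

lemma has_integral_tent: "(tent has_integral 1) {0..1}"
proof -
  have "((\<lambda>t. 4 * t) has_integral 2 * (1/2)\<^sup>2 - 2 * 0\<^sup>2) {0..1/2::real}"
    by (rule fundamental_theorem_of_calculus)
       (auto intro!: derivative_eq_intros simp flip: has_real_derivative_iff_has_vector_derivative)
  then have "(tent has_integral 1/2) {0..1/2}"
    by (rule has_integral_eq[rotated, where f = "\<lambda>t. 4 * t", THEN has_integral_eq_rhs])
       (auto simp: tent_def power2_eq_square)
  moreover have "((\<lambda>t. 4 - 4 * t) has_integral (4 * 1 - 2 * 1\<^sup>2) - (4 * (1/2) - 2 * (1/2)\<^sup>2)) {1/2..1::real}"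
    by (rule fundamental_theorem_of_calculus)
       (auto intro!: derivative_eq_intros simp flip: has_real_derivative_iff_has_vector_derivative)
  then have "(tent has_integral 1/2) {1/2..1}"
    by (rule has_integral_eq[rotated, where f = "\<lambda>t. 4 - 4 * t", THEN has_integral_eq_rhs])
       (auto simp: tent_def power2_eq_square)
  ultimately have "(tent has_integral 1/2 + 1/2) {0..1}"
    by (intro has_integral_combine[of 0 "1/2" 1]) auto
  then show ?thesis by simp
qed

lemma bump_nonneg: "0 \<le> bump n \<alpha>"
  by (simp add: bump_def tent_nonneg)

lemma bump_le: "bump n \<alpha> \<le> 2"
proof -
  have "tent (\<alpha> / 2 ^ n - 1) / 2 ^ n \<le> tent (\<alpha> / 2 ^ n - 1) / 1"
    by (intro divide_left_mono tent_nonneg) auto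
  then show ?thesis using tent_le[of "\<alpha> / 2 ^ n - 1"] by (simp add: bump_def)
qed

text \<open>Stretching by 2^n and lowering by 2^n divides slopes by 4^n, so the constant of
  \<open>tent\<close> serves all \<open>n\<close> and any mixture of bumps.\<close>

lemma bump_Lipschitz: "\<bar>bump n x - bump n y\<bar> \<le> 4 * \<bar>x - y\<bar>"
proof -
  have "\<bar>bump n x - bump n y\<bar> = \<bar>tent (x / 2 ^ n - 1) - tent (y / 2 ^ n - 1)\<bar> / 2 ^ n"
    by (simp add: bump_def flip: diff_divide_distrib)
  also have "\<dots> \<le> (4 * \<bar>x / 2 ^ n - y / 2 ^ n\<bar>) / 2 ^ n"
    using tent_Lipschitz[of "x / 2 ^ n - 1" "y / 2 ^ n - 1"] by (intro divide_right_mono) auto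
  also have "\<dots> = 4 * \<bar>x - y\<bar> / (2 ^ n * 2 ^ n)"
    by (simp flip: diff_divide_distrib)
  also have "\<dots> \<le> 4 * \<bar>x - y\<bar> / 1"
    using mult_mono[of 1 "2 ^ n" 1 "2 ^ n :: real"] by (intro divide_left_mono) auto
  finally show ?thesis by simp
qed

lemma continuous_on_bump: "continuous_on X (bump n)"
  unfolding bump_def by (intro continuous_intros) auto

text \<open>The height factor of \<open>bump\<close> cancels the Jacobian of the affine
  substitution, and since \<open>tent\<close> vanishes off [0, 1], integrability on the line reduces
  to continuity on a compact interval.\<close>

lemma has_bochner_integral_bump:
  assumes "continuous_on UNIV G"
  shows "has_bochner_integral lborel (\<lambda>\<alpha>. G \<alpha> * bump n \<alpha>) (bump_mean G n)"
proof -
  let ?g = "\<lambda>t. G (2 ^ n * (1 + t)) * tent t"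
  have "continuous_on {0..1} ?g"
    by (intro continuous_intros continuous_on_compose2[OF assms]) auto
  then have int: "set_integrable lborel {0..1} ?g"
    unfolding set_integrable_def by (intro borel_integrable_compact) auto
  have ind: "indicator {0..1} t *\<^sub>R ?g t = ?g t" for t
    using tent_outside[of t] by (auto simp: indicator_def)
  have "has_bochner_integral lborel ?g (bump_mean G n)"
    using int set_borel_integral_eq_integral(2)[OF int]
    by (simp only: bump_mean_def has_bochner_integral_iff set_integrable_def set_lebesgue_integral_def ind)
  have shift: "bump n (2 ^ n + 2 ^ n * t) = tent t / 2 ^ n" for t
    by (simp add: bump_def add_divide_distrib)
  from has_bochner_integral_divide_zero[OF \<open>has_bochner_integral lborel ?g (bump_mean G n)\<close>, of "2 ^ n"]
  have "has_bochner_integral lborel (\<lambda>t. G (2 ^ n + 2 ^ n * t) * bump n (2 ^ n + 2 ^ n * t))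
      (bump_mean G n / 2 ^ n)"
    by (simp add: shift distrib_left)
  then show ?thesis
    by (subst lborel_has_bochner_integral_real_affine_iff[where c = "2 ^ n" and t = "2 ^ n"])
       (simp_all add: divide_inverse mult.commute)
qed

lemma bump_mean_1: "bump_mean (\<lambda>_. 1) n = 1"
  unfolding bump_mean_def using has_integral_tent by (simp add: integral_unique)

lemma comp_real_fam_tent:
  assumes "comp_real_fam k x" shows "comp_real_fam k (\<lambda>xs. tent (x xs))"
proof -
  have z: "comp_real_fam k (\<lambda>xs. 2 - 4 * \<bar>x xs - 1 / 2 ^ 1\<bar>)"
    by (rule comp_real_fam_diff comp_real_fam_mult_rat comp_real_fam_abs assms comp_real_fam_of_rat
        comp_rat_fam_intros recursive_on_const)+
  \<comment> \<open>The positive part of z is (z + |z|) / 2.\<close>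
  have "comp_real_fam k (\<lambda>xs. 1 / 2 ^ 1 * ((2 - 4 * \<bar>x xs - 1 / 2 ^ 1\<bar>) + \<bar>2 - 4 * \<bar>x xs - 1 / 2 ^ 1\<bar>\<bar>))"
    by (rule comp_real_fam_mult_rat comp_real_fam_add comp_real_fam_abs z comp_rat_fam_intros
        recursive_on_const)+
  then show ?thesis
    by (rule comp_real_fam_cong[THEN iffD1, rotated]) (auto simp: tent_def max_def)
qed

text \<open>At the nodes of a Riemann sum \<open>tent\<close> is a rational factor, as
  \<open>comp_real_fam_mult_rat\<close> requires for its product with the real logarithm.\<close>

lemma comp_rat_fam_tent:
  assumes "comp_rat_fam k x" shows "comp_rat_fam k (\<lambda>xs. tent (x xs))"
proof -
  have "comp_rat_fam k (\<lambda>xs. max 0 (2 - 4 * \<bar>x xs - 1 / 2 ^ 1\<bar>))"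
    by (rule comp_rat_fam_intros assms recursive_on_const)+
  then show ?thesis by (simp add: tent_def)
qed

lemma comp_real_fam_bump:
  assumes n: "recursive_on k n" and x: "comp_real_fam k x"
  shows "comp_real_fam k (\<lambda>xs. bump (n xs) (x xs))"
proof -
  have "comp_real_fam k (\<lambda>xs. 1 / 2 ^ n xs * tent (1 / 2 ^ n xs * x xs - 1))"
    by (rule comp_real_fam_mult_rat comp_real_fam_tent comp_real_fam_diff x comp_real_fam_of_rat
        comp_rat_fam_intros n)+
  then show ?thesis by (simp add: bump_def)
qed

section \<open>Logarithmic moments of bumps\<close>

text \<open>What is left of the logarithmic moment of \<open>bump n\<close> once 2 n and - log2 s
  have been split off.\<close>

definition log_mean :: "real \<Rightarrow> real \<Rightarrow> nat \<Rightarrow> real" where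
  "log_mean P s n = integral {0..1} (\<lambda>t. tent t * log 2 (s / 4 ^ n + P * (1 + t)\<^sup>2))"

text \<open>The argument of the logarithm stays in [P, s + 4 P] for every \<open>n\<close>, so its
  logarithm lies between those of the two endpoints.\<close>

definition log_mean_bound :: "real \<Rightarrow> real \<Rightarrow> real" where
  "log_mean_bound P s = \<bar>log 2 P\<bar> + \<bar>log 2 (s + 4 * P)\<bar>"

context
  fixes P s :: real
  assumes P: "P > 0" and s: "s > 0"
begin

lemma log_argument_bounds:
  assumes "0 \<le> t"
  shows "P \<le> s / 4 ^ n + P * (1 + t)\<^sup>2" "t \<le> 1 \<Longrightarrow> s / 4 ^ n + P * (1 + t)\<^sup>2 \<le> s + 4 * P"
proof -
  have "P * 1 \<le> P * (1 + t)\<^sup>2" using assms P by (intro mult_left_mono) auto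
  then show "P \<le> s / 4 ^ n + P * (1 + t)\<^sup>2" using s by (simp add: add_increasing)
  assume "t \<le> 1"
  then have "P * (1 + t)\<^sup>2 \<le> P * 2\<^sup>2" using assms P by (intro mult_left_mono power_mono) auto
  moreover have "s / 4 ^ n \<le> s / 1" using s by (intro divide_left_mono) auto
  ultimately show "s / 4 ^ n + P * (1 + t)\<^sup>2 \<le> s + 4 * P" by simp
qed

lemma log_argument_abs:
  assumes "0 \<le> t" "t \<le> 1"
  shows "\<bar>log 2 (s / 4 ^ n + P * (1 + t)\<^sup>2)\<bar> \<le> log_mean_bound P s"
proof -
  have "log 2 P \<le> log 2 (s / 4 ^ n + P * (1 + t)\<^sup>2)"
    "log 2 (s / 4 ^ n + P * (1 + t)\<^sup>2) \<le> log 2 (s + 4 * P)"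
    using log_argument_bounds[of t n] assms P by auto
  then show ?thesis unfolding log_mean_bound_def by linarith
qed

text \<open>Product rule: 16 is the maximum 2 of \<open>tent\<close> times the Lipschitz constant 8
  of the logarithm, and 4 is the slope of \<open>tent\<close>. The 8 is 2 / P from
  \<open>log2_Lipschitz\<close> times the bound 4 P on the slope of the argument. Nothing depends on
  \<open>n\<close>.\<close>

lemma log_mean_integrand_Lipschitz:
  "(16 + 4 * log_mean_bound P s)-lipschitz_on {0..1}
     (\<lambda>t. tent t * log 2 (s / 4 ^ n + P * (1 + t)\<^sup>2))"
proof (rule lipschitz_onI)
  let ?K = "log_mean_bound P s" and ?l = "\<lambda>t. log 2 (s / 4 ^ n + P * (1 + t)\<^sup>2)"
  fix x y :: real assume x: "x \<in> {0..1}" and y: "y \<in> {0..1}"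
  have "\<bar>(s / 4 ^ n + P * (1 + x)\<^sup>2) - (s / 4 ^ n + P * (1 + y)\<^sup>2)\<bar> = P * ((2 + x + y) * \<bar>x - y\<bar>)"
  proof -
    have "(s / 4 ^ n + P * (1 + x)\<^sup>2) - (s / 4 ^ n + P * (1 + y)\<^sup>2) = P * ((2 + x + y) * (x - y))"
      by (simp add: power2_eq_square algebra_simps)
    moreover have "\<bar>P * ((2 + x + y) * (x - y))\<bar> = P * ((2 + x + y) * \<bar>x - y\<bar>)"
      using P x y by (simp add: abs_mult)
    ultimately show ?thesis by (simp only:)
  qed
  also have "\<dots> \<le> P * (4 * \<bar>x - y\<bar>)"
    using P x y by (intro mult_left_mono mult_right_mono) auto
  finally have le: "\<bar>(s / 4 ^ n + P * (1 + x)\<^sup>2) - (s / 4 ^ n + P * (1 + y)\<^sup>2)\<bar> \<le> P * (4 * \<bar>x - y\<bar>)" .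
  have "\<bar>?l x - ?l y\<bar> \<le> 2 * \<bar>(s / 4 ^ n + P * (1 + x)\<^sup>2) - (s / 4 ^ n + P * (1 + y)\<^sup>2)\<bar> / P"
    using log_argument_bounds(1)[of x n] log_argument_bounds(1)[of y n] x y P
    by (intro log2_Lipschitz) auto
  also have "\<dots> \<le> 2 * (P * (4 * \<bar>x - y\<bar>)) / P"
    using le P by (intro divide_right_mono mult_left_mono) auto
  finally have l: "\<bar>?l x - ?l y\<bar> \<le> 8 * \<bar>x - y\<bar>" using P by simp
  have prod_diff: "a * b - c * d = a * (b - d) + d * (a - c)" for a b c d :: real
    by (simp add: algebra_simps)
  have "\<bar>tent x * ?l x - tent y * ?l y\<bar> = \<bar>tent x * (?l x - ?l y) + ?l y * (tent x - tent y)\<bar>"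
    by (rule arg_cong[OF prod_diff])
  also have "\<dots> \<le> \<bar>tent x\<bar> * \<bar>?l x - ?l y\<bar> + \<bar>?l y\<bar> * \<bar>tent x - tent y\<bar>"
    unfolding abs_mult[symmetric] by (rule abs_triangle_ineq)
  also have "\<dots> \<le> 2 * (8 * \<bar>x - y\<bar>) + ?K * (4 * \<bar>x - y\<bar>)"
    using tent_nonneg[of x] tent_le[of x] l tent_Lipschitz[of x y] log_argument_abs[of y n] y
    by (intro add_mono mult_mono) auto
  also have "\<dots> = (16 + 4 * ?K) * \<bar>x - y\<bar>" by (simp add: distrib_right)
  finally show "dist (tent x * ?l x) (tent y * ?l y) \<le> (16 + 4 * ?K) * dist x y"
    unfolding dist_real_def .
qed (simp add: log_mean_bound_def)

lemma log_mean_abs_le: "\<bar>log_mean P s n\<bar> \<le> 2 * log_mean_bound P s"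
proof -
  have "norm (log_mean P s n) \<le> 2 * log_mean_bound P s * (1 - 0)"
    unfolding log_mean_def
  proof (rule integral_bound)
    show "continuous_on {0..1} (\<lambda>t. tent t * log 2 (s / 4 ^ n + P * (1 + t)\<^sup>2))"
      using log_mean_integrand_Lipschitz by (rule lipschitz_on_continuous_on)
    fix t :: real assume "t \<in> {0..1}"
    then have "\<bar>tent t\<bar> * \<bar>log 2 (s / 4 ^ n + P * (1 + t)\<^sup>2)\<bar> \<le> 2 * log_mean_bound P s"
      using tent_nonneg[of t] tent_le[of t] by (intro mult_mono log_argument_abs) auto
    then show "norm (tent t * log 2 (s / 4 ^ n + P * (1 + t)\<^sup>2)) \<le> 2 * log_mean_bound P s"
      by (simp only: real_norm_def abs_mult)
  qed simp
  then show ?thesis by simp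
qed

text \<open>The identity is exact: 4^n / s factors out of the argument, and its logarithm is
  multiplied by the mass 1 of \<open>tent\<close>.\<close>

lemma bump_mean_log:
  "bump_mean (\<lambda>\<alpha>. log 2 (1 + P * \<alpha>\<^sup>2 / s)) n = 2 * real n + log_mean P s n - log 2 s"
proof -
  let ?h = "\<lambda>t. tent t * log 2 (s / 4 ^ n + P * (1 + t)\<^sup>2)"
  have "?h integrable_on {0..1}"
    by (intro integrable_continuous_real lipschitz_on_continuous_on[OF log_mean_integrand_Lipschitz])
  then have "(?h has_integral log_mean P s n) {0..1}"
    unfolding log_mean_def by (rule integrable_integral)
  from has_integral_add[OF this has_integral_mult_right[OF has_integral_tent, of "2 * real n - log 2 s"]]
  have "((\<lambda>t. ?h t + (2 * real n - log 2 s) * tent t) has_integral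
      2 * real n + log_mean P s n - log 2 s) {0..1}" by (rule has_integral_eq_rhs) simp
  then have "((\<lambda>t. log 2 (1 + P * (2 ^ n * (1 + t))\<^sup>2 / s) * tent t) has_integral
      2 * real n + log_mean P s n - log 2 s) {0..1}"
  proof (rule has_integral_eq[rotated])
    fix t :: real assume "t \<in> {0..1}"
    then have pos: "s / 4 ^ n + P * (1 + t)\<^sup>2 > 0"
      using log_argument_bounds(1)[of t n] P by auto
    have "(2 ^ n :: real)\<^sup>2 = 4 ^ n" by (simp add: power2_eq_square flip: power_mult_distrib)
    then have "(2 ^ n * (1 + t))\<^sup>2 = 4 ^ n * (1 + t)\<^sup>2" by (simp add: power_mult_distrib)
    moreover have "1 + P * (4 ^ n * q) / s = 4 ^ n * (s / 4 ^ n + P * q) / s" for q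
      using s by (simp add: field_simps)
    ultimately have "1 + P * (2 ^ n * (1 + t))\<^sup>2 / s = 4 ^ n * (s / 4 ^ n + P * (1 + t)\<^sup>2) / s"
      by simp
    then have "log 2 (1 + P * (2 ^ n * (1 + t))\<^sup>2 / s) =
        log 2 (4 ^ n) + log 2 (s / 4 ^ n + P * (1 + t)\<^sup>2) - log 2 s"
      using pos s by (simp add: log_divide log_mult)
    also have "log 2 (4 ^ n) = 2 * real n"
      using log_nat_power[of "2::real" 2 "2 * n"] by (simp add: power_mult)
    finally have E: "log 2 (1 + P * (2 ^ n * (1 + t))\<^sup>2 / s) =
        2 * real n + log 2 (s / 4 ^ n + P * (1 + t)\<^sup>2) - log 2 s" .
    show "?h t + (2 * real n - log 2 s) * tent t = log 2 (1 + P * (2 ^ n * (1 + t))\<^sup>2 / s) * tent t"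
      unfolding E by (simp add: algebra_simps)
  qed
  then show ?thesis unfolding bump_mean_def by (rule integral_unique)
qed

lemma comp_real_fam_log_mean:
  assumes "computable_real P" "computable_real s" and n: "recursive_on k n"
  shows "comp_real_fam k (\<lambda>xs. log_mean P s (n xs))"
  unfolding log_mean_def
proof -
  \<comment> \<open>\<open>e\<close> and \<open>c\<close> are not computed from \<open>P\<close> and
    \<open>s\<close>; two fixed naturals that work for all \<open>n\<close> are enough.\<close>
  obtain e where e: "1 / P < 2 ^ e" using real_arch_pow[of 2 "1 / P"] by auto
  obtain c where c: "16 + 4 * log_mean_bound P s < 2 ^ c"
    using real_arch_pow[of 2 "16 + 4 * log_mean_bound P s"] by auto
  have n': "recursive_on (Suc (Suc k)) (\<lambda>ys. n (tl (tl ys)))"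
    by (rule recursive_on_subst[OF n] recursive_on_vars)+
  let ?t = "\<lambda>ys. real (hd ys) / 2 ^ hd (tl ys)"
  have t: "comp_rat_fam (Suc (Suc k)) ?t"
    by (rule comp_rat_fam_intros recursive_on_vars)+
  \<comment> \<open>The argument is written as rational families times the reals \<open>s\<close>
    and \<open>P\<close>, with 4^n as a power of two, to match the closure rules.\<close>
  have arg: "comp_real_fam (Suc (Suc k)) (\<lambda>ys. 1 / 2 ^ (2 * n (tl (tl ys))) * s + ((1 + ?t ys) * (1 + ?t ys)) * P)"
    by (intro comp_real_fam_add comp_real_fam_mult_rat comp_real_fam_const assms t
        comp_rat_fam_intros recursive_on_mult recursive_on_const n')
  have eq: "1 / 2 ^ (2 * n (tl (tl ys))) * s + ((1 + ?t ys) * (1 + ?t ys)) * P =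
      s / 4 ^ n (tl (tl ys)) + P * (1 + ?t ys)\<^sup>2" for ys
    by (simp add: power_mult power2_eq_square mult.commute[of _ P])
  have "comp_real_fam (Suc (Suc k)) (\<lambda>ys. tent (?t ys) * log 2 (s / 4 ^ n (tl (tl ys)) + P * (1 + ?t ys)\<^sup>2))"
  proof (intro comp_real_fam_mult_rat comp_rat_fam_tent t comp_real_fam_log[where c = e] arg[unfolded eq])
    fix ys
    have "1 / 2 ^ e \<le> P" using e P by (simp add: field_simps)
    also have "\<dots> \<le> s / 4 ^ n (tl (tl ys)) + P * (1 + ?t ys)\<^sup>2"
      by (rule log_argument_bounds) simp
    finally show "1 / 2 ^ e \<le> s / 4 ^ n (tl (tl ys)) + P * (1 + ?t ys)\<^sup>2" .
  qed
  then show "comp_real_fam k (\<lambda>xs. integral {0..1} (\<lambda>t. tent t * log 2 (s / 4 ^ n xs + P * (1 + t)\<^sup>2)))"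
    by (rule comp_real_fam_integral[where c = c and
          h = "\<lambda>xs t. tent t * log 2 (s / 4 ^ n xs + P * (1 + t)\<^sup>2)"])
       (rule lipschitz_on_le[OF log_mean_integrand_Lipschitz less_imp_le[OF c]])
qed

end

section \<open>Mixtures of bumps\<close>

text \<open>The scales \<open>A\<close> are left free: all size and Lipschitz estimates come from
  the weights alone, so the scales may grow as fast as the logarithm requires.\<close>

locale bump_mixture =
  fixes w :: "nat \<Rightarrow> real" and A :: "nat \<Rightarrow> nat"
  assumes w_nonneg: "0 \<le> w k" and w_le: "w k \<le> 1 / 2 ^ Suc k"
begin

definition part :: "nat \<Rightarrow> real \<Rightarrow> real" where
  "part k \<alpha> = w k * bump (A k) \<alpha> + (1 / 2 ^ Suc k - w k) * bump 0 \<alpha>"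

definition density :: "real \<Rightarrow> real" where
  "density \<alpha> = (\<Sum>k. part k \<alpha>)"

definition part_mean :: "(real \<Rightarrow> real) \<Rightarrow> nat \<Rightarrow> real" where
  "part_mean G k = w k * bump_mean G (A k) + (1 / 2 ^ Suc k - w k) * bump_mean G 0"

lemma part_nonneg: "0 \<le> part k \<alpha>"
  unfolding part_def using w_nonneg[of k] w_le[of k] by (intro add_nonneg_nonneg mult_nonneg_nonneg bump_nonneg) auto

lemma part_le: "part k \<alpha> \<le> 1 / 2 ^ k"
proof -
  have "part k \<alpha> \<le> w k * 2 + (1 / 2 ^ Suc k - w k) * 2"
    unfolding part_def using w_nonneg[of k] w_le[of k]
    by (intro add_mono mult_left_mono bump_le) auto
  also have "\<dots> = 1 / 2 ^ k" by (simp add: left_diff_distrib)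
  finally show ?thesis .
qed

text \<open>The two weights of a part are nonnegative and add up to 2^-(k+1), so the constants are
  summable and every partial sum is 4-Lipschitz.\<close>

lemma part_Lipschitz: "\<bar>part k x - part k y\<bar> \<le> 4 * \<bar>x - y\<bar> / 2 ^ Suc k"
proof -
  have "part k x - part k y = w k * (bump (A k) x - bump (A k) y) + (1 / 2 ^ Suc k - w k) * (bump 0 x - bump 0 y)"
    unfolding part_def by (simp only: right_diff_distrib)
  also have "\<bar>\<dots>\<bar> \<le> \<bar>w k * (bump (A k) x - bump (A k) y)\<bar> + \<bar>(1 / 2 ^ Suc k - w k) * (bump 0 x - bump 0 y)\<bar>"
    by (rule abs_triangle_ineq)
  also have "\<dots> \<le> w k * (4 * \<bar>x - y\<bar>) + (1 / 2 ^ Suc k - w k) * (4 * \<bar>x - y\<bar>)"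
    unfolding abs_mult using w_nonneg[of k] w_le[of k]
    by (intro add_mono mult_mono bump_Lipschitz) auto
  also have "\<dots> = 4 * \<bar>x - y\<bar> / 2 ^ Suc k" by (simp add: left_diff_distrib)
  finally show ?thesis .
qed

lemma part_abs_le: "\<bar>part k \<alpha>\<bar> \<le> 1 / 2 ^ k"
  using part_nonneg[of k \<alpha>] part_le[of k \<alpha>] by simp

lemma summable_part: "summable (\<lambda>k. part k \<alpha>)"
  using part_abs_le by (rule suminf_geometric_bound(1))

lemma part_sum_le_density: "(\<Sum>k<n. part k \<alpha>) \<le> density \<alpha>"
  unfolding density_def by (intro sum_le_suminf summable_part part_nonneg) auto

lemma density_nonneg: "0 \<le> density \<alpha>"
  using part_sum_le_density[where n = 0] by simp

lemma continuous_on_part: "continuous_on X (part k)"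
  unfolding part_def by (intro continuous_intros continuous_on_bump)

lemma continuous_on_density: "continuous_on UNIV density"
proof (rule uniform_limit_theorem)
  show "uniform_limit UNIV (\<lambda>n \<alpha>. \<Sum>k<n. part k \<alpha>) density sequentially"
    unfolding density_def
    by (rule Weierstrass_m_test[where M = "\<lambda>k. 1 / 2 ^ k"])
       (use part_abs_le suminf_geometric_bound(1)[of "\<lambda>k. 1 / 2 ^ k" 1] in auto)
qed (auto intro!: always_eventually continuous_intros continuous_on_part)

lemma has_bochner_integral_part:
  assumes "continuous_on UNIV G"
  shows "has_bochner_integral lborel (\<lambda>\<alpha>. G \<alpha> * part k \<alpha>) (part_mean G k)"
proof -
  have "has_bochner_integral lborel
      (\<lambda>\<alpha>. w k * (G \<alpha> * bump (A k) \<alpha>) + (1 / 2 ^ Suc k - w k) * (G \<alpha> * bump 0 \<alpha>)) (part_mean G k)"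
    unfolding part_mean_def
    by (intro has_bochner_integral_add has_bochner_integral_mult_right has_bochner_integral_bump assms)
  also have "(\<lambda>\<alpha>. w k * (G \<alpha> * bump (A k) \<alpha>) + (1 / 2 ^ Suc k - w k) * (G \<alpha> * bump 0 \<alpha>)) =
      (\<lambda>\<alpha>. G \<alpha> * part k \<alpha>)"
    unfolding part_def distrib_left by (simp only: mult.left_commute)
  finally show ?thesis .
qed

text \<open>All terms are nonnegative, hence equal to their norms, and convergence of the means
  already justifies exchanging sum and integral, even for unbounded \<open>G\<close>.\<close>

lemma has_bochner_integral_density:
  assumes G: "continuous_on UNIV G" "\<And>\<alpha>. 0 \<le> G \<alpha>" and sums: "part_mean G sums I"
  shows "has_bochner_integral lborel (\<lambda>\<alpha>. G \<alpha> * density \<alpha>) I"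
proof -
  have eq: "G \<alpha> * density \<alpha> = (\<Sum>k. G \<alpha> * part k \<alpha>)" for \<alpha>
    unfolding density_def by (rule suminf_mult[OF summable_part, symmetric])
  have norm: "norm (G \<alpha> * part k \<alpha>) = G \<alpha> * part k \<alpha>" for \<alpha> k
    using G(2) part_nonneg by simp
  have int: "integrable lborel (\<lambda>\<alpha>. G \<alpha> * part k \<alpha>)" "(LINT \<alpha>|lborel. G \<alpha> * part k \<alpha>) = part_mean G k" for k
    using has_bochner_integral_part[OF G(1), of k] by (simp_all add: has_bochner_integral_iff)
  have ae: "AE \<alpha> in lborel. summable (\<lambda>k. norm (G \<alpha> * part k \<alpha>))"
    unfolding norm by (intro always_eventually allI summable_mult summable_part)
  have sm: "summable (\<lambda>k. LINT \<alpha>|lborel. norm (G \<alpha> * part k \<alpha>))"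
    unfolding norm int(2) using sums by (rule sums_summable)
  show ?thesis
    unfolding has_bochner_integral_iff eq
    using integrable_suminf[OF int(1) ae sm] integral_suminf[OF int(1) ae sm] sums
    by (simp add: int(2) sums_unique[symmetric])
qed

text \<open>The weight \<open>w k\<close> cancels, so the total mass is known exactly.\<close>

lemma part_mean_1: "part_mean (\<lambda>_. 1) k = 1 / 2 ^ Suc k"
  by (simp add: part_mean_def bump_mean_1)

lemma half_powers_sums: "(\<lambda>k. 1 / 2 ^ Suc k :: real) sums 1"
  using power_half_series by (simp add: power_one_over)

lemma has_bochner_integral_density_1: "has_bochner_integral lborel density 1"
  using has_bochner_integral_density[of "\<lambda>_. 1" 1] half_powers_sums
  by (simp add: part_mean_1[abs_def])

lemma cont_pdf_density: "cont_pdf density"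
  using has_bochner_integral_density_1 continuous_on_density density_nonneg
  by (simp add: cont_pdf_def has_bochner_integral_iff)

lemma comp_fun_seq_part_sum:
  assumes w: "comp_rat_seq w" and A: "recursive A"
  shows "comp_fun_seq (\<lambda>n \<alpha>. \<Sum>k<n. part k \<alpha>)"
  unfolding comp_fun_seq_def
proof (intro conjI allI impI)
  fix x assume x: "comp_real_seq x"
  \<comment> \<open>The list is summation index, number of terms, index of the point; hence the
    point is \<open>x (tl ys ! 1)\<close>.\<close>
  have i: "recursive_on (Suc 2) (\<lambda>ys. hd ys)" and j: "recursive_on (Suc 2) (\<lambda>ys. tl ys ! 1)"
    and N: "recursive_on 2 (\<lambda>xs. xs ! 0)"
    by (rule recursive_on_vars lessI zero_less_numeral | simp)+
  have "comp_real_fam (Suc 2) (\<lambda>ys. w (hd ys) * bump (A (hd ys)) (x (tl ys ! 1)) +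
      (1 / 2 ^ Suc (hd ys) - w (hd ys)) * bump 0 (x (tl ys ! 1)))"
    by (intro comp_real_fam_add comp_real_fam_mult_rat comp_real_fam_bump comp_rat_fam_intros
        comp_rat_seq_app[OF w] recursive_app[OF A] comp_real_seq_app[OF x] recursive_on_Suc
        recursive_on_const i j)
  then show "comp_real_fam 2 (\<lambda>xs. \<Sum>k<xs ! 0. part k (x (xs ! 1)))"
    unfolding part_def by (rule comp_real_fam_sum[where F = "\<lambda>k xs. w k * bump (A k) (x (xs ! 1)) +
      (1 / 2 ^ Suc k - w k) * bump 0 (x (xs ! 1))"]) (rule N)
next
  \<comment> \<open>One modulus serves all indices and intervals, and 4 / 2^(N+2) = 2^-N.\<close>
  define d :: "nat list \<Rightarrow> nat" where "d xs = 2 ^ (xs ! 2 + 2)" for xs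
  have "recursive_on 3 d"
    unfolding d_def by (intro recursive_on_power recursive_on_add recursive_on_const recursive_on_nth) simp
  moreover have "\<bar>(\<Sum>k<n. part k x) - (\<Sum>k<n. part k y)\<bar> \<le> 2 powr - real N"
    if "\<bar>x - y\<bar> \<le> 1 / real (d [n, M, N])" for n M N x y
  proof -
    have "\<bar>(\<Sum>k<n. part k x) - (\<Sum>k<n. part k y)\<bar> \<le> (\<Sum>k<n. 4 * \<bar>x - y\<bar> * (1 / 2 ^ Suc k))"
      unfolding sum_subtractf[symmetric] using part_Lipschitz
      by (intro order_trans[OF sum_abs] sum_mono) (simp only: times_divide_eq_right mult_1_right)
    also have "\<dots> = 4 * \<bar>x - y\<bar> * (\<Sum>k<n. 1 / 2 ^ Suc k)" by (simp only: sum_distrib_left)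
    also have "\<dots> \<le> 4 * \<bar>x - y\<bar> * 1"
      using sum_le_suminf[OF sums_summable[OF half_powers_sums], of "{..<n}"] sums_unique[OF half_powers_sums]
      by (intro mult_left_mono) auto
    also have "\<dots> \<le> 4 * (1 / 2 ^ (N + 2))" using that by (simp add: d_def)
    also have "\<dots> = 2 powr - real N" by (simp add: two_powr_minus_nat power_add)
    finally show ?thesis .
  qed
  ultimately show "\<exists>d. recursive_on 3 d \<and> (\<forall>n M N. 0 < d [n, M, N] \<and>
      (\<forall>x y. \<bar>x\<bar> \<le> real M \<longrightarrow> \<bar>y\<bar> \<le> real M \<longrightarrow> \<bar>x - y\<bar> \<le> 1 / real (d [n, M, N]) \<longrightarrow>
        \<bar>(\<Sum>k<n. part k x) - (\<Sum>k<n. part k y)\<bar> \<le> 2 powr - real N))"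
    by (intro exI[of _ d]) (simp add: d_def)
qed

text \<open>The distance to the n-th partial sum is the missing mass, exactly 2^-n, so the identity
  is a modulus of convergence.\<close>

lemma computable_L1_density:
  assumes "comp_rat_seq w" "recursive A"
  shows "computable_L1 density"
  unfolding computable_L1_def
proof (intro conjI exI allI impI)
  have part: "has_bochner_integral lborel (part k) (1 / 2 ^ Suc k)" for k
    using has_bochner_integral_part[of "\<lambda>_. 1" k] by (simp add: part_mean_1)
  have sum: "has_bochner_integral lborel (\<lambda>\<alpha>. \<Sum>k<n. part k \<alpha>) (\<Sum>k<n. 1 / 2 ^ Suc k)" for n
    using part by (intro has_bochner_integral_sum)
  show "integrable lborel density" "integrable lborel (\<lambda>\<alpha>. \<Sum>k<n. part k \<alpha>)" for n
    using has_bochner_integral_density_1 sum[of n] by (simp_all add: has_bochner_integral_iff)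
  show "comp_fun_seq (\<lambda>n \<alpha>. \<Sum>k<n. part k \<alpha>)" using assms by (rule comp_fun_seq_part_sum)
  show "recursive (\<lambda>n. n)" by (rule recursiveI) (rule recursive_on_vars)+
  fix M n :: nat assume "M \<le> n"
  have geo: "(\<Sum>k<n. 1 / 2 ^ Suc k) = 1 - 1 / (2::real) ^ n"
    by (induction n) (simp_all add: field_simps)
  \<comment> \<open>Partial sums stay below the density, so the absolute value disappears.\<close>
  have "(LINT \<alpha>|lborel. \<bar>density \<alpha> - (\<Sum>k<n. part k \<alpha>)\<bar>) = (LINT \<alpha>|lborel. density \<alpha> - (\<Sum>k<n. part k \<alpha>))"
    using part_sum_le_density by (intro Bochner_Integration.integral_cong) auto
  also have "\<dots> = 1 - (1 - 1 / 2 ^ n)"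
    using has_bochner_integral_diff[OF has_bochner_integral_density_1 sum[of n]]
    unfolding geo by (rule has_bochner_integral_integral_eq)
  also have "\<dots> \<le> 2 powr - real M"
    using \<open>M \<le> n\<close> by (simp add: two_powr_minus_nat frac_le power_increasing)
  finally show "(LINT \<alpha>|lborel. \<bar>density \<alpha> - (\<Sum>k<n. part k \<alpha>)\<bar>) \<le> 2 powr - real M" .
qed

text \<open>\<open>a\<close> enters only as the value of the main series and may be noncomputable;
  everything that depends on \<open>P\<close> and \<open>s\<close> is collected in
  \<open>u\<close>.\<close>

lemma log_moment_density:
  assumes w: "comp_rat_seq w" and A: "recursive A"
    and a: "(\<lambda>k. 2 * w k * real (A k)) sums a"
    and P: "computable_real P" "P > 0" and s: "computable_real s" "s > 0"
  shows "\<exists>u. computable_real u \<and>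
    has_bochner_integral lborel (\<lambda>\<alpha>. log 2 (1 + P * \<alpha>\<^sup>2 / s) * density \<alpha>) (a + u)"
proof -
  let ?G = "\<lambda>\<alpha>. log 2 (1 + P * \<alpha>\<^sup>2 / s)" and ?K = "log_mean_bound P s"
  \<comment> \<open>The correction of index \<open>k\<close>: a combination of bounded means with
    total weight 2^-(k+1), hence geometrically small.\<close>
  define c where "c k = w k * log_mean P s (A k) + (1 / 2 ^ Suc k - w k) * log_mean P s 0" for k
  obtain e where e: "?K < 2 ^ e" using real_arch_pow[of 2 ?K] by auto
  have K: "?K \<ge> 0" by (simp add: log_mean_bound_def)
  have c_le: "\<bar>c k\<bar> \<le> 2 ^ e / 2 ^ k" for k
  proof -
    have "\<bar>c k\<bar> \<le> \<bar>w k * log_mean P s (A k)\<bar> + \<bar>(1 / 2 ^ Suc k - w k) * log_mean P s 0\<bar>"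
      unfolding c_def by (rule abs_triangle_ineq)
    also have "\<dots> \<le> w k * (2 * ?K) + (1 / 2 ^ Suc k - w k) * (2 * ?K)"
      unfolding abs_mult using w_nonneg[of k] w_le[of k] log_mean_abs_le[OF P(2) s(2)] K
      by (intro add_mono mult_mono) auto
    also have "\<dots> = ?K / 2 ^ k" by (simp add: left_diff_distrib)
    also have "\<dots> \<le> 2 ^ e / 2 ^ k" using e by (intro divide_right_mono) auto
    finally show ?thesis .
  qed
  have "comp_real_fam (Suc 0) (\<lambda>ys. w (hd ys) * log_mean P s (A (hd ys)) +
      (1 / 2 ^ Suc (hd ys) - w (hd ys)) * log_mean P s 0)"
    by (rule comp_real_fam_add comp_real_fam_mult_rat comp_real_fam_log_mean[OF P(2) s(2) P(1) s(1)]
        comp_rat_fam_intros comp_rat_seq_app[OF w] recursive_app[OF A] recursive_on_Suc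
        recursive_on_const recursive_on_vars)+
  then have "comp_real_fam (Suc 0) (\<lambda>ys. c (hd ys))" unfolding c_def .
  then have c_comp: "computable_real (\<Sum>k. c k)"
    unfolding computable_real_iff
    by (rule comp_real_fam_suminf[where F = "\<lambda>k xs. c k" and c = e]) (rule c_le)
  obtain q where q: "1 / s < 2 ^ q" using real_arch_pow[of 2 "1 / s"] by auto
  have "comp_real_fam 0 (\<lambda>_. log 2 s)"
    by (rule comp_real_fam_log[where c = q]) (use s q in \<open>auto simp: field_simps intro: comp_real_fam_const\<close>)
  then have u: "computable_real ((\<Sum>k. c k) - log 2 s)"
    using c_comp by (intro computable_real_diff) (simp_all add: computable_real_iff)
  \<comment> \<open>Each index carries its main term, its correction and a share of - log2 s
    proportional to its mass; the shares add up to one full - log2 s.\<close>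
  have pm: "part_mean ?G k = 2 * w k * real (A k) + (c k - log 2 s * (1 / 2 ^ Suc k))" for k
  proof -
    have "p * (2 * n + y - l) + (v - p) * (2 * 0 + z - l) = 2 * p * n + ((p * y + (v - p) * z) - l * v)"
      for p n y l v z :: real by (simp add: algebra_simps)
    then show ?thesis
      unfolding part_mean_def bump_mean_log[OF P(2) s(2)] c_def of_nat_0 .
  qed
  have "(\<lambda>k. 2 * w k * real (A k) + (c k - log 2 s * (1 / 2 ^ Suc k))) sums
      (a + ((\<Sum>k. c k) - log 2 s * 1))"
    using suminf_geometric_bound(1)[OF c_le]
    by (intro sums_add a sums_diff summable_sums sums_mult half_powers_sums)
  then have "part_mean ?G sums (a + ((\<Sum>k. c k) - log 2 s))"
    unfolding pm[symmetric] by simp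
  moreover have ge: "1 \<le> 1 + P * \<alpha>\<^sup>2 / s" for \<alpha> using P(2) s(2) by simp
  have pos: "0 < 1 + P * \<alpha>\<^sup>2 / s" for \<alpha> using ge[of \<alpha>] by linarith
  have "0 \<le> ?G \<alpha>" for \<alpha> using ge[of \<alpha>] pos[of \<alpha>] by (subst zero_le_log_cancel_iff) auto
  moreover have "continuous_on UNIV ?G"
    unfolding log_def using s(2) pos by (intro continuous_intros) (auto simp: less_imp_neq[symmetric])
  ultimately have "has_bochner_integral lborel (\<lambda>\<alpha>. ?G \<alpha> * density \<alpha>) (a + ((\<Sum>k. c k) - log 2 s))"
    by (intro has_bochner_integral_density)
  with u show ?thesis by blast
qed

end

text \<open>The order of quantifiers is the point: \<open>f\<close> depends on \<open>a\<close>
  alone and is fixed before \<open>P\<close> and \<open>s\<close>, and only \<open>u\<close> reacts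
  to them.\<close>

lemma Sigma1_log_moment:
  assumes "a \<in> Sigma1"
  shows "\<exists>f. cont_pdf f \<and> computable_L1 f \<and>
    (\<forall>P s. computable_real P \<and> P > 0 \<and> computable_real s \<and> s > 0 \<longrightarrow>
      (\<exists>u. computable_real u \<and>
        has_bochner_integral lborel (\<lambda>\<alpha>. log 2 (1 + P * \<alpha>\<^sup>2 / s) * f \<alpha>) (a + u)))"
proof -
  obtain r where r: "comp_rat_seq r" "incseq r" "r \<longlonglongrightarrow> a"
    using assms by (auto simp: Sigma1_def)
  \<comment> \<open>The maximum with 0 makes \<open>D\<close> positive even for a constant sequence,
    so every \<open>A k\<close> can be divided by.\<close>
  obtain D :: nat where D: "a - r 0 < real D" "D > 0"
    using reals_Archimedean2[of "max 0 (a - r 0)"] by (auto simp: max_less_iff_conj)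
  define A where "A k = D * 2 ^ k" for k
  \<comment> \<open>The 2 cancels the one in 2 n = log2 (4^n), so the main term of index
    \<open>k\<close> is the increment itself.\<close>
  define w where "w k = (r (Suc k) - r k) / real (2 * A k)" for k
  have A_pos: "A k > 0" for k using D by (simp add: A_def)
  interpret bump_mixture w A
  proof
    fix k
    have le: "r k \<le> r (Suc k)" "r 0 \<le> r k" "r (Suc k) \<le> a"
      using r(2) incseq_le[OF r(2,3)] by (auto simp: mono_def)
    then show "0 \<le> w k" by (simp add: w_def)
    have "w k \<le> real D / real (2 * A k)"
      unfolding w_def using le D by (intro divide_right_mono) auto
    also have "\<dots> = 1 / 2 ^ Suc k" using D by (simp add: A_def)
    finally show "w k \<le> 1 / 2 ^ Suc k" .
  qed
  have A_rec: "recursive A" unfolding A_def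
    by (rule recursiveI) (rule recursive_on_mult recursive_on_power recursive_on_const recursive_on_vars)+
  have "comp_rat_fam (Suc 0) (\<lambda>xs. (r (Suc (hd xs)) - r (hd xs)) / real (2 * A (hd xs)))"
  proof (rule comp_rat_fam_divide_nat)
    show "comp_rat_fam (Suc 0) (\<lambda>xs. r (Suc (hd xs)) - r (hd xs))"
      by (rule comp_rat_fam_diff comp_rat_seq_app[OF r(1)] recursive_on_Suc recursive_on_vars)+
    show "recursive_on (Suc 0) (\<lambda>xs. 2 * A (hd xs))"
      by (rule recursive_on_mult recursive_on_const recursive_app[OF A_rec] recursive_on_vars)+
  qed (simp add: A_pos)
  then have w_comp: "comp_rat_seq w" unfolding w_def by (rule comp_rat_seqI)
  have "2 * w k * real (A k) = r (Suc k) - r k" for k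
    using A_pos[of k] by (simp add: w_def)
  then have sums: "(\<lambda>k. 2 * w k * real (A k)) sums (a - r 0)"
    using telescope_sums[OF r(3)] by simp
  have "comp_real_fam 0 (\<lambda>_. r 0)"
    by (intro comp_real_fam_of_rat comp_rat_seq_app[OF r(1)] recursive_on_const)
  then have r0: "computable_real (r 0)" by (simp add: computable_real_iff)
  show ?thesis
  proof (intro exI[of _ density] conjI allI impI)
    show "cont_pdf density" by (rule cont_pdf_density)
    show "computable_L1 density" using w_comp A_rec by (rule computable_L1_density)
    fix P s assume "computable_real P \<and> P > 0 \<and> computable_real s \<and> s > 0"
    then obtain u where u: "computable_real u"
      "has_bochner_integral lborel (\<lambda>\<alpha>. log 2 (1 + P * \<alpha>\<^sup>2 / s) * density \<alpha>) (a - r 0 + u)"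
      using log_moment_density[OF w_comp A_rec sums, of P s] by auto
    \<comment> \<open>The rational \<open>r 0\<close> left over by the telescoping moves into the
      computable part.\<close>
    have "a - r 0 + u = a + (u - r 0)" by simp
    with u r0 show "\<exists>u. computable_real u \<and>
        has_bochner_integral lborel (\<lambda>\<alpha>. log 2 (1 + P * \<alpha>\<^sup>2 / s) * density \<alpha>) (a + u)"
      by (metis computable_real_diff)
  qed
qed

theorem theorem1:
  fixes x s1 s2 :: real
  assumes "x \<in> Delta2" and "x > 0" and "x \<notin> Sigma1" and "x \<notin> Pi1"
    and "computable_real s1" and "computable_real s2" and "s1 > 0" and "s2 > 0"
  shows "\<exists>f1 f2. cont_pdf f1 \<and> cont_pdf f2 \<and> computable_L1 f1 \<and> computable_L1 f2 \<and>
    (\<forall>P. computable_real P \<and> P > 0 \<longrightarrow>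
       integrable lborel (\<lambda>a. log 2 (1 + P * a\<^sup>2 / s1) * f1 a) \<and>
       integrable lborel (\<lambda>a. log 2 (1 + P * a\<^sup>2 / s2) * f2 a) \<and>
       (\<exists>u. computable_real u \<and> secrecy_capacity P f1 f2 s1 s2 = x + u)) \<and>
    (\<forall>P. computable_real P \<and> P > 0 \<longrightarrow>
       secrecy_capacity P f1 f2 s1 s2 \<in> Delta2 \<and>
       secrecy_capacity P f1 f2 s1 s2 \<notin> Sigma1 \<and>
       secrecy_capacity P f1 f2 s1 s2 \<notin> Pi1)"
proof -
  obtain a b where ab: "a \<in> Sigma1" "b \<in> Sigma1" "x = a - b"
    using assms(1) by (auto simp: Delta2_def)
  obtain f1 where f1: "cont_pdf f1" "computable_L1 f1"
    "\<And>P. computable_real P \<Longrightarrow> P > 0 \<Longrightarrow> \<exists>u. computable_real u \<and>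
       has_bochner_integral lborel (\<lambda>\<alpha>. log 2 (1 + P * \<alpha>\<^sup>2 / s1) * f1 \<alpha>) (a + u)"
    using Sigma1_log_moment[OF ab(1)] assms(5,7) by metis
  obtain f2 where f2: "cont_pdf f2" "computable_L1 f2"
    "\<And>P. computable_real P \<Longrightarrow> P > 0 \<Longrightarrow> \<exists>u. computable_real u \<and>
       has_bochner_integral lborel (\<lambda>\<alpha>. log 2 (1 + P * \<alpha>\<^sup>2 / s2) * f2 \<alpha>) (b + u)"
    using Sigma1_log_moment[OF ab(2)] assms(6,8) by metis
  \<comment> \<open>Integrability is carried along because \<open>LINT\<close> defaults to 0 for a
    function that is not integrable; with it the capacity is a difference of genuine
    integrals.\<close>
  have main: "integrable lborel (\<lambda>a. log 2 (1 + P * a\<^sup>2 / s1) * f1 a) \<and>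
       integrable lborel (\<lambda>a. log 2 (1 + P * a\<^sup>2 / s2) * f2 a) \<and>
       (\<exists>u. computable_real u \<and> secrecy_capacity P f1 f2 s1 s2 = x + u)"
    if P: "computable_real P \<and> P > 0" for P
  proof -
    obtain u where u: "computable_real u"
      "has_bochner_integral lborel (\<lambda>\<alpha>. log 2 (1 + P * \<alpha>\<^sup>2 / s1) * f1 \<alpha>) (a + u)"
      using f1(3) P by blast
    obtain v where v: "computable_real v"
      "has_bochner_integral lborel (\<lambda>\<alpha>. log 2 (1 + P * \<alpha>\<^sup>2 / s2) * f2 \<alpha>) (b + v)"
      using f2(3) P by blast
    have "secrecy_capacity P f1 f2 s1 s2 = x + (u - v)"
      using u(2) v(2) ab(3) by (simp add: secrecy_capacity_def has_bochner_integral_iff)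
    moreover have "computable_real (u - v)" using u(1) v(1) by (rule computable_real_diff)
    ultimately show ?thesis using u(2) v(2) by (auto simp: has_bochner_integral_iff)
  qed
  show ?thesis
  proof (rule exI[of _ f1], rule exI[of _ f2], intro conjI f1(1,2) f2(1,2) allI impI)
    fix P assume P: "computable_real P \<and> P > 0"
    from main[OF P]
    show "integrable lborel (\<lambda>a. log 2 (1 + P * a\<^sup>2 / s1) * f1 a)"
      "integrable lborel (\<lambda>a. log 2 (1 + P * a\<^sup>2 / s2) * f2 a)"
      "\<exists>u. computable_real u \<and> secrecy_capacity P f1 f2 s1 s2 = x + u" by blast+
    then obtain u where u: "computable_real u" "secrecy_capacity P f1 f2 s1 s2 = x + u" by blast
    show "secrecy_capacity P f1 f2 s1 s2 \<in> Delta2"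
      unfolding u(2) using assms(1) u(1) by (rule Delta2_add_computable)
    show "secrecy_capacity P f1 f2 s1 s2 \<notin> Sigma1" "secrecy_capacity P f1 f2 s1 s2 \<notin> Pi1"
      unfolding u(2) Sigma1_add_computable_iff[OF u(1)] Pi1_add_computable_iff[OF u(1)] by fact+
  qed
qed

end
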